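(* Assume that $y'=f(y)$ has an equilibrium at infinity in the direction $x_\ast\in\mathcal{E}$. Suppose that the desingularized vector field $g$ is $C^1$ on an open set $V\subset\overline{\mathcal{D}}$ with $\mathcal{E}\subset V$, and that $x_\ast$ is hyperbolic with $n_s>0$ (resp. $n_u=n-n_s$) eigenvalues of the Jacobian matrix $Jg(x_\ast)$ with negative (resp. positive) real parts. Let $y(t)$ be a solution of $y'=f(y)$ whose image $x=T_{qP}(y)$ is on the stable manifold $W^s(x_\ast)$ for $g$. Then $t_{\max}<\infty$ holds; namely, $y(t)$ is a blow-up solution. Moreover, $$p(y(t))\sim C(t_{\max}-t)^{-1/k}\quad\text{as } t\to t_{\max},$$ where $k+1$ is the order of the asymptotically quasi-homogeneous vector field $f$. Finally, if the $i$-th component $(x_\ast)_i$ of $x_\ast$ with $i\in I_\alpha$ is not zero, then also $$y_i(t)\sim C(t_{\max}-t)^{-\alpha_i/k}\quad\text{as } t\to t_{\max}.$$ (Here $C$ denotes a constant, possibly different in the two formulas.)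
   Context: **Asymptotically quasi-homogeneous fields.** Let $\alpha=(\alpha_1,\dots,\alpha_n)\ne(0,\dots,0)$ be nonnegative integers, $I_\alpha=\{i:\alpha_i>0\}$, $l=\#I_\alpha$. A set $U\subset\mathbb{R}^n$ is admissible with respect to $\alpha$ if it consists of all $x$ with $x_i\in\mathbb{R}$ arbitrary for $i\in I_\alpha$ and $(x_j)_{j\notin I_\alpha}\in\tilde U$ for an open set $\tilde U\subset\mathbb{R}^{n-l}$. A function $F$ is quasi-homogeneous of type $\alpha$ and order $m$ if $F(R^{\alpha_1}x_1,\dots,R^{\alpha_n}x_n)=R^mF(x)$ for all $x$ and $R\in\mathbb{R}$; a smooth vector field is quasi-homogeneous of type $\alpha$ and order $k+1$ if its $j$-th component is quasi-homogeneous of type $\alpha$ and order $k+\alpha_j$ for each $j$. A smooth $f:U\to\mathbb{R}^n$ ($U$ admissible), bounded in the remaining coordinates for each fixed value of $(x_i)_{i\in I_\alpha}$, is asymptotically quasi-homogeneous of type $\alpha$ and order $k+1$ at infinity if there is a quasi-homogeneous vector field $f_{\alpha,k}$ of type $\alpha$ and order $k+1$ such that, for all $j$, $\lim_{R\to+\infty}R^{-(k+\alpha_j)}\{f_j(R^{\alpha_1}x_1,\dots,R^{\alpha_n}x_n)-R^{k+\alpha_j}(f_{\alpha,k})_j(x)\}=0$ uniformly on $\{x:(x_i)_{i\in I_\alpha}\in S^{l-1},\ (x_j)_{j\notin I_\alpha}\in\tilde U\}$. Throughout, $y'=f(y)$ (with $'=d/dt$) where $f:U\to\mathbb{R}^n$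 is smooth and asymptotically quasi-homogeneous of type $\alpha$ and order $k+1$, with integer $k\ge1$. **Quasi-Poincaré compactification.** Fix reals $a_1,\dots,a_n\ge1$, $c\in\mathbb{N}$ and integers $\beta_i$ with $\alpha_i\beta_i=c$ for $i\in I_\alpha$, $\beta_i=0$ otherwise. Put $p(y)=(\sum_{i\in I_\alpha}a_iy_i^{2\beta_i})^{1/2c}$, $\kappa(y)=(1+p(y)^{2c})^{1/2c}$, $T_{qP}(y)=x$ with $x_i=y_i/\kappa(y)^{\alpha_i}$. Let $\mathcal{D}=\{x=T_{qP}(y):y\in U\}=\{x\in U:p(x)<1\}$, $\mathcal{E}=\{x\in U:p(x)=1\}$ (the horizon), $\overline{\mathcal{D}}=\mathcal{D}\cup\mathcal{E}$. For $x\in\mathcal{D}$ set $\tilde f_j(x)=\kappa^{-(k+\alpha_j)}f_j(\kappa^{\alpha_1}x_1,\dots,\kappa^{\alpha_n}x_n)$ with $\kappa=\kappa(T_{qP}^{-1}(x))=(1-\sum_{j\in I_\alpha}a_jx_j^{2\beta_j})^{-1/2c}$, extended to $\mathcal{E}$ by its limit $(f_{\alpha,k})_j$. With $d\tau=\kappa(y(t))^kdt$, the system becomes $dx/d\tau=g(x)$, where the desingularized vector field is $g_i(x)=\tilde f_i-\big(\sum_{j\in I_\alpha}\beta_ja_jx_j^{2\beta_j-1}\tilde f_j\big)\frac{x_i}{\beta_i}$ for $i\in I_\alpha$ and $g_i=\tilde f_i$ for $i\notin I_\alpha$. The system $y'=f(y)$ has an equilibrium at infinity in the direction $x_\ast$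 if $x_\ast\in\mathcal{E}$ and $g(x_\ast)=0$. $t_{\max}$ is the maximal (forward) existence time of $y(t)$. $F\sim G$ means that $\lim F/G$ exists and is a nonzero constant. *)

theory Defs
  imports "HOL-Analysis.Analysis" "HOL-Computational_Algebra.Polynomial"
begin

section \<open>Smooth maps\<close>

text \<open>
  Order-\<open>m\<close> differentiability through iterated directional derivatives. On an open
  subset of a finite-dimensional space this is the usual notion of class \<open>C\<^sup>m\<close>.
\<close>

primrec Ck_on :: "nat \<Rightarrow> 'a::euclidean_space set \<Rightarrow> ('a \<Rightarrow> 'b::real_normed_vector) \<Rightarrow> bool" where
  "Ck_on 0 S f \<longleftrightarrow> continuous_on S f"
| "Ck_on (Suc m) S f \<longleftrightarrow>
     (\<forall>x\<in>S. f differentiable (at x)) \<and>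
     (\<forall>v. Ck_on m S (\<lambda>x. frechet_derivative f (at x) v))"

definition smooth_on :: "'a::euclidean_space set \<Rightarrow> ('a \<Rightarrow> 'b::real_normed_vector) \<Rightarrow> bool" where
  "smooth_on S f \<longleftrightarrow> (\<forall>m. Ck_on m S f)"

text \<open>
  Class \<open>C\<^sup>1\<close> on a set that need not be open in the ambient space (below: a relatively open
  part of a region with boundary); derivatives are taken within the set.
\<close>

definition C1_on :: "'a::real_normed_vector set \<Rightarrow> ('a \<Rightarrow> 'b::real_normed_vector) \<Rightarrow> bool" where
  "C1_on V g \<longleftrightarrow>
     (\<exists>g'. (\<forall>x\<in>V. (g has_derivative blinfun_apply (g' x)) (at x within V)) \<and> continuous_on V g')"


section \<open>Asymptotically quasi-homogeneous vector fields\<close>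

definition hom_idx :: "('n \<Rightarrow> nat) \<Rightarrow> 'n set" where
  "hom_idx \<alpha> = {i. \<alpha> i > 0}"

definition qh_scale :: "('n::finite \<Rightarrow> nat) \<Rightarrow> real \<Rightarrow> real^'n \<Rightarrow> real^'n" where
  "qh_scale \<alpha> R x = (\<chi> i. R ^ \<alpha> i * x $ i)"

text \<open>
  The space of the remaining coordinates \<open>(x\<^sub>j)\<close>, with \<open>j\<close> outside \<^term>\<open>hom_idx \<alpha>\<close>, is the
  finite product of copies of the real line over that index set (a one-point space if the
  index set is empty); its points are functions that are \<^term>\<open>undefined\<close> off the index set.
\<close>

definition admissible_set :: "('n::finite \<Rightarrow> nat) \<Rightarrow> (real^'n) set \<Rightarrow> bool" where
  "admissible_set \<alpha> U \<longleftrightarrow>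
     (\<exists>Ut. openin (product_topology (\<lambda>_. euclideanreal) (- hom_idx \<alpha>)) Ut \<and>
           U = {x. restrict (\<lambda>j. x $ j) (- hom_idx \<alpha>) \<in> Ut})"

definition quasi_homogeneous ::
  "('n::finite \<Rightarrow> nat) \<Rightarrow> nat \<Rightarrow> (real^'n) set \<Rightarrow> (real^'n \<Rightarrow> real) \<Rightarrow> bool" where
  "quasi_homogeneous \<alpha> m U F \<longleftrightarrow> (\<forall>x\<in>U. \<forall>R. F (qh_scale \<alpha> R x) = R ^ m * F x)"

text \<open>The argument \<open>k\<close> stands for order \<open>k + 1\<close>.\<close>

definition quasi_homogeneous_field ::
  "('n::finite \<Rightarrow> nat) \<Rightarrow> nat \<Rightarrow> (real^'n) set \<Rightarrow> (real^'n \<Rightarrow> real^'n) \<Rightarrow> bool" where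
  "quasi_homogeneous_field \<alpha> k U h \<longleftrightarrow>
     smooth_on U h \<and> (\<forall>j. quasi_homogeneous \<alpha> (k + \<alpha> j) U (\<lambda>x. h x $ j))"

text \<open>
  \<open>f\<close> is asymptotically quasi-homogeneous of type \<open>\<alpha>\<close> and order \<open>k + 1\<close> at infinity, and
  \<open>fk\<close> is the quasi-homogeneous vector field that witnesses this.
\<close>

definition asymp_quasi_homogeneous ::
  "('n::finite \<Rightarrow> nat) \<Rightarrow> nat \<Rightarrow> (real^'n) set \<Rightarrow> (real^'n \<Rightarrow> real^'n) \<Rightarrow> (real^'n \<Rightarrow> real^'n) \<Rightarrow> bool"
where
  "asymp_quasi_homogeneous \<alpha> k U f fk \<longleftrightarrow>
     smooth_on U f \<and>
     (\<forall>z. bounded (f ` {x \<in> U. \<forall>i\<in>hom_idx \<alpha>. x $ i = z $ i})) \<and>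
     quasi_homogeneous_field \<alpha> k U fk \<and>
     (\<forall>j. uniform_limit {x \<in> U. (\<Sum>i\<in>hom_idx \<alpha>. (x $ i)\<^sup>2) = 1}
            (\<lambda>R x. (f (qh_scale \<alpha> R x) $ j - R ^ (k + \<alpha> j) * fk x $ j) / R ^ (k + \<alpha> j))
            (\<lambda>_. 0) at_top)"


section \<open>Quasi-Poincare compactification\<close>

text \<open>
  Parameters: exponents \<open>\<alpha>\<close>, \<open>\<beta>\<close>, weights \<open>a\<close> and \<open>c\<close>, with \<open>\<alpha>\<^sub>i \<beta>\<^sub>i = c > 0\<close> for \<open>i\<close>
  in \<^term>\<open>hom_idx \<alpha>\<close>. Such integers \<open>\<beta>\<^sub>i\<close> are positive, so \<open>\<beta>\<close> is taken in the naturals.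
\<close>

definition qp_sum :: "('n::finite \<Rightarrow> nat) \<Rightarrow> ('n \<Rightarrow> nat) \<Rightarrow> ('n \<Rightarrow> real) \<Rightarrow> real^'n \<Rightarrow> real" where
  "qp_sum \<alpha> \<beta> a y = (\<Sum>i\<in>hom_idx \<alpha>. a i * (y $ i) ^ (2 * \<beta> i))"

definition qp_p ::
  "('n::finite \<Rightarrow> nat) \<Rightarrow> ('n \<Rightarrow> nat) \<Rightarrow> ('n \<Rightarrow> real) \<Rightarrow> nat \<Rightarrow> real^'n \<Rightarrow> real" where
  "qp_p \<alpha> \<beta> a c y = qp_sum \<alpha> \<beta> a y powr (1 / (2 * real c))"

definition qp_kappa ::
  "('n::finite \<Rightarrow> nat) \<Rightarrow> ('n \<Rightarrow> nat) \<Rightarrow> ('n \<Rightarrow> real) \<Rightarrow> nat \<Rightarrow> real^'n \<Rightarrow> real" where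
  "qp_kappa \<alpha> \<beta> a c y = (1 + qp_p \<alpha> \<beta> a c y ^ (2 * c)) powr (1 / (2 * real c))"

definition qp_T ::
  "('n::finite \<Rightarrow> nat) \<Rightarrow> ('n \<Rightarrow> nat) \<Rightarrow> ('n \<Rightarrow> real) \<Rightarrow> nat \<Rightarrow> real^'n \<Rightarrow> real^'n" where
  "qp_T \<alpha> \<beta> a c y = (\<chi> i. y $ i / qp_kappa \<alpha> \<beta> a c y ^ \<alpha> i)"

definition qp_D ::
  "('n::finite \<Rightarrow> nat) \<Rightarrow> ('n \<Rightarrow> nat) \<Rightarrow> ('n \<Rightarrow> real) \<Rightarrow> nat \<Rightarrow> (real^'n) set \<Rightarrow> (real^'n) set" where
  "qp_D \<alpha> \<beta> a c U = {x \<in> U. qp_p \<alpha> \<beta> a c x < 1}"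

definition qp_horizon ::
  "('n::finite \<Rightarrow> nat) \<Rightarrow> ('n \<Rightarrow> nat) \<Rightarrow> ('n \<Rightarrow> real) \<Rightarrow> nat \<Rightarrow> (real^'n) set \<Rightarrow> (real^'n) set" where
  "qp_horizon \<alpha> \<beta> a c U = {x \<in> U. qp_p \<alpha> \<beta> a c x = 1}"

definition qp_Dbar ::
  "('n::finite \<Rightarrow> nat) \<Rightarrow> ('n \<Rightarrow> nat) \<Rightarrow> ('n \<Rightarrow> real) \<Rightarrow> nat \<Rightarrow> (real^'n) set \<Rightarrow> (real^'n) set" where
  "qp_Dbar \<alpha> \<beta> a c U = qp_D \<alpha> \<beta> a c U \<union> qp_horizon \<alpha> \<beta> a c U"

text \<open>\<open>\<kappa>\<close> in terms of \<open>x = T(y)\<close>, i.e. \<open>\<kappa>(T\<^sup>-\<^sup>1(x))\<close>.\<close>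

definition qp_kappa_inv ::
  "('n::finite \<Rightarrow> nat) \<Rightarrow> ('n \<Rightarrow> nat) \<Rightarrow> ('n \<Rightarrow> real) \<Rightarrow> nat \<Rightarrow> real^'n \<Rightarrow> real" where
  "qp_kappa_inv \<alpha> \<beta> a c x = (1 - qp_sum \<alpha> \<beta> a x) powr (- 1 / (2 * real c))"

text \<open>
  The rescaled field; \<open>fk\<close> gives the limit values on the horizon. Values
  outside \<^term>\<open>qp_Dbar \<alpha> \<beta> a c U\<close> are irrelevant.
\<close>

definition qp_ftilde ::
  "('n::finite \<Rightarrow> nat) \<Rightarrow> ('n \<Rightarrow> nat) \<Rightarrow> ('n \<Rightarrow> real) \<Rightarrow> nat \<Rightarrow> nat \<Rightarrow>
   (real^'n \<Rightarrow> real^'n) \<Rightarrow> (real^'n \<Rightarrow> real^'n) \<Rightarrow> real^'n \<Rightarrow> real^'n" where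
  "qp_ftilde \<alpha> \<beta> a c k f fk x =
     (if qp_p \<alpha> \<beta> a c x < 1
      then let K = qp_kappa_inv \<alpha> \<beta> a c x
           in \<chi> j. f (qh_scale \<alpha> K x) $ j / K ^ (k + \<alpha> j)
      else fk x)"

definition qp_g ::
  "('n::finite \<Rightarrow> nat) \<Rightarrow> ('n \<Rightarrow> nat) \<Rightarrow> ('n \<Rightarrow> real) \<Rightarrow> nat \<Rightarrow> nat \<Rightarrow>
   (real^'n \<Rightarrow> real^'n) \<Rightarrow> (real^'n \<Rightarrow> real^'n) \<Rightarrow> real^'n \<Rightarrow> real^'n" where
  "qp_g \<alpha> \<beta> a c k f fk x =
     (let F = qp_ftilde \<alpha> \<beta> a c k f fk x in
      \<chi> i. if i \<in> hom_idx \<alpha>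
           then F $ i - (\<Sum>j\<in>hom_idx \<alpha>. real (\<beta> j) * a j * (x $ j) ^ (2 * \<beta> j - 1) * F $ j)
                          * (x $ i / real (\<beta> i))
           else F $ i)"

definition equilibrium_at_infinity ::
  "('n::finite \<Rightarrow> nat) \<Rightarrow> ('n \<Rightarrow> nat) \<Rightarrow> ('n \<Rightarrow> real) \<Rightarrow> nat \<Rightarrow> nat \<Rightarrow> (real^'n) set \<Rightarrow>
   (real^'n \<Rightarrow> real^'n) \<Rightarrow> (real^'n \<Rightarrow> real^'n) \<Rightarrow> real^'n \<Rightarrow> bool" where
  "equilibrium_at_infinity \<alpha> \<beta> a c k U f fk xs \<longleftrightarrow>
     xs \<in> qp_horizon \<alpha> \<beta> a c U \<and> qp_g \<alpha> \<beta> a c k f fk xs = 0"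


section \<open>Eigenvalues of real matrices\<close>

definition cmat :: "real^'n^'n \<Rightarrow> complex^'n^'n" where
  "cmat A = map_matrix complex_of_real A"

definition eigenval :: "real^'n^'n \<Rightarrow> complex \<Rightarrow> bool" where
  "eigenval A z \<longleftrightarrow> (\<exists>v. v \<noteq> 0 \<and> cmat A *v v = z *s v)"

definition charpoly :: "real^'n^'n \<Rightarrow> complex poly" where
  "charpoly A = det (mat [:0, 1:] - map_matrix (\<lambda>z. [:z:]) (cmat A))"

text \<open>Numbers of eigenvalues in the open half-planes, counted with algebraic multiplicity.\<close>

definition n_stable :: "real^'n^'n \<Rightarrow> nat" where
  "n_stable A = (\<Sum>z | eigenval A z \<and> Re z < 0. order z (charpoly A))"

definition n_unstable :: "real^'n^'n \<Rightarrow> nat" where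
  "n_unstable A = (\<Sum>z | eigenval A z \<and> Re z > 0. order z (charpoly A))"

definition hyperbolic_matrix :: "real^'n^'n \<Rightarrow> bool" where
  "hyperbolic_matrix A \<longleftrightarrow> (\<forall>z. eigenval A z \<longrightarrow> Re z \<noteq> 0)"


section \<open>Solutions, stable manifolds and asymptotics\<close>

definition solution_on ::
  "('a::real_normed_vector \<Rightarrow> 'a) \<Rightarrow> 'a set \<Rightarrow> real set \<Rightarrow> (real \<Rightarrow> 'a) \<Rightarrow> bool" where
  "solution_on f U J y \<longleftrightarrow>
     (\<forall>t\<in>J. y t \<in> U \<and> (y has_vector_derivative f (y t)) (at t within J))"

definition forward_interval :: "real \<Rightarrow> ereal \<Rightarrow> real set" where
  "forward_interval t0 T = {t. t0 \<le> t \<and> ereal t < T}"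

text \<open>\<open>T\<close> is the maximal forward existence time of the solution \<open>y\<close> started at time \<open>t0\<close>.\<close>

definition maximal_forward_solution ::
  "('a::real_normed_vector \<Rightarrow> 'a) \<Rightarrow> 'a set \<Rightarrow> real \<Rightarrow> ereal \<Rightarrow> (real \<Rightarrow> 'a) \<Rightarrow> bool" where
  "maximal_forward_solution f U t0 T y \<longleftrightarrow>
     ereal t0 < T \<and> solution_on f U (forward_interval t0 T) y \<and>
     (\<forall>T' z. T < T' \<and> (\<forall>t\<in>forward_interval t0 T. z t = y t) \<longrightarrow>
             \<not> solution_on f U (forward_interval t0 T') z)"

text \<open>Global stable manifold of \<open>xs\<close> for the flow of \<open>g\<close> on \<open>S\<close>.\<close>

definition stable_manifold ::
  "('a::real_normed_vector \<Rightarrow> 'a) \<Rightarrow> 'a set \<Rightarrow> 'a \<Rightarrow> 'a set" where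
  "stable_manifold g S xs =
     {x. \<exists>u. u 0 = x \<and> solution_on g S {0..} u \<and> (u \<longlongrightarrow> xs) at_top}"

definition asymp_proportional ::
  "(real \<Rightarrow> real) \<Rightarrow> (real \<Rightarrow> real) \<Rightarrow> real filter \<Rightarrow> bool" where
  "asymp_proportional F G net \<longleftrightarrow> (\<exists>L. L \<noteq> 0 \<and> ((\<lambda>t. F t / G t) \<longlongrightarrow> L) net)"

end

theory Submission
  imports Defs
begin

text \<open>
  Write \<open>s = p\<^sup>2\<^sup>c\<close>, so that the horizon is \<open>s = 1\<close> and \<open>\<kappa>\<^sup>-\<^sup>2\<^sup>c = 1 - s\<close>, and let
  \<open>G = \<Sum> \<beta>\<^sub>j a\<^sub>j x\<^sub>j\<^bsup>2 \<beta>\<^sub>j - 1\<^esup> F\<^sub>j\<close>, the sum over \<open>j \<in> I\<^sub>\<alpha>\<close>, where \<open>F\<close> is the rescaled field. The proof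
  rests on one identity, \<open>\<nabla>s \<bullet> g = 2 G (1 - s)\<close> (\<open>grad_s_g\<close>): along \<open>dx/d\<tau> = g(x)\<close> the
  distance to the horizon \<open>w = 1 - s\<close> satisfies the linear equation \<open>dw/d\<tau> = -2 G w\<close>, that is,
  \<open>d\<kappa>/d\<tau> = (G/c) \<kappa>\<close>.

  The identity has two consequences. First, differentiating it at the equilibrium \<open>x\<^sub>*\<close> shows that
  \<open>\<nabla>s(x\<^sub>*)\<close> is a left eigenvector of the Jacobian with eigenvalue \<open>-2 G(x\<^sub>*)\<close>
  (\<open>jacobian_normal\<close>). Hyperbolicity excludes \<open>G(x\<^sub>*) = 0\<close>, and a trajectory inside the horizon
  that tends to \<open>x\<^sub>*\<close> excludes \<open>G(x\<^sub>*) < 0\<close>. Both the differentiation and the linear equation need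
  \<open>G\<close> to be continuous up to the horizon, which is where the uniformity of the quasi-homogeneous limit
  enters (\<open>F_continuous\<close>).

  Second, put \<open>m = \<kappa>\<^sup>-\<^sup>k = dt/d\<tau>\<close>. Its logarithmic derivative is \<open>-(k/c) G\<close>, which tends to the
  negative number \<open>-(k/c) G(x\<^sub>*)\<close>. Hence the total time \<open>\<integral> m d\<tau>\<close> is finite, and by de l'Hospital's
  argument the quotient of the density \<open>m\<close> by the remaining time \<open>B - t\<close> tends to \<open>(k/c) G(x\<^sub>*)\<close>
  (\<open>density_over_tail_tendsto\<close>). So \<open>\<kappa>\<^sup>k (B - t)\<close> has a positive limit, and the rates follow from
  \<open>p(y) = \<kappa> p(x)\<close> and \<open>y\<^sub>i = \<kappa>\<^bsup>\<alpha>\<^sub>i\<^esup> x\<^sub>i\<close> with \<open>x \<rightarrow> x\<^sub>*\<close> (\<open>asymptotics_at_horizon\<close>).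

  The trajectory \<open>u\<close> given by the stable manifold starts at the image of \<open>y(t\<^sub>0)\<close>. Pulled back and
  reparametrized by \<open>t\<close> it solves \<open>y' = f(y)\<close> on \<open>[t\<^sub>0, B)\<close>; uniqueness and maximality of \<open>y\<close> identify
  it with \<open>y\<close> and \<open>B\<close> with \<open>t\<^sub>m\<^sub>a\<^sub>x\<close> (\<open>maximal_solution_blows_up\<close>).
\<close>

section \<open>Decaying densities and the change of time\<close>

lemma nonneg_if_decreasing_to_0:
  fixes h :: "real \<Rightarrow> real"
  assumes "\<And>s. s \<ge> T \<Longrightarrow> \<exists>D. (h has_real_derivative D) (at s) \<and> D \<le> 0"
    and "(h \<longlongrightarrow> 0) at_top" and "t \<ge> T"
  shows "h t \<ge> 0"
proof (rule tendsto_upperbound[OF assms(2)])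
  show "\<forall>\<^sub>F s in at_top. h s \<le> h t"
    using eventually_ge_at_top[of t]
  proof eventually_elim
    case (elim s)
    show ?case
      by (rule DERIV_nonpos_imp_nonincreasing[OF elim]) (use assms in auto)
  qed
qed simp

text \<open>
  The quotient of the derivatives of \<open>m\<close> and \<open>n\<close> is \<open>r\<close>, so this is de l'Hospital's rule for two
  functions that vanish at infinity. For every \<open>d > 0\<close> the functions \<open>m - (L - d) n\<close> and
  \<open>(L + d) n - m\<close> are eventually decreasing and tend to \<open>0\<close>, hence are nonnegative.
\<close>

lemma density_over_tail_tendsto:
  fixes m n r :: "real \<Rightarrow> real"
  assumes m: "\<And>t. (m has_real_derivative - r t * m t) (at t)"
    and n: "\<And>t. (n has_real_derivative - m t) (at t)"
    and m_pos: "\<And>t. m t > 0" and n_pos: "\<And>t. n t > 0"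
    and m0: "(m \<longlongrightarrow> 0) at_top" and n0: "(n \<longlongrightarrow> 0) at_top" and r: "(r \<longlongrightarrow> L) at_top"
  shows "((\<lambda>t. m t / n t) \<longlongrightarrow> L) at_top"
proof (rule tendstoI)
  fix e :: real assume "e > 0"
  define d where "d = e / 2"
  have d: "d > 0" "d < e" using \<open>e > 0\<close> by (auto simp: d_def)
  obtain T where T: "\<And>t. t \<ge> T \<Longrightarrow> \<bar>r t - L\<bar> < d"
    using tendstoD[OF r d(1)] by (auto simp: eventually_at_top_linorder dist_real_def)
  have *: "\<bar>m t - L * n t\<bar> \<le> d * n t" if "t \<ge> T" for t
  proof -
    have "m t - (L - d) * n t \<ge> 0"
    proof (rule nonneg_if_decreasing_to_0[where h = "\<lambda>t. m t - (L - d) * n t", OF _ _ that])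
      fix s assume "s \<ge> T"
      have "((\<lambda>t. m t - (L - d) * n t) has_real_derivative (L - d - r s) * m s) (at s)"
        by (auto intro!: derivative_eq_intros m n simp: algebra_simps)
      moreover have "(L - d - r s) * m s \<le> 0"
        using T[OF \<open>s \<ge> T\<close>] m_pos[of s] by (intro mult_nonpos_nonneg) auto
      ultimately show "\<exists>D. ((\<lambda>t. m t - (L - d) * n t) has_real_derivative D) (at s) \<and> D \<le> 0"
        by blast
    qed (auto intro!: tendsto_eq_intros m0 n0)
    moreover have "(L + d) * n t - m t \<ge> 0"
    proof (rule nonneg_if_decreasing_to_0[where h = "\<lambda>t. (L + d) * n t - m t", OF _ _ that])
      fix s assume "s \<ge> T"
      have "((\<lambda>t. (L + d) * n t - m t) has_real_derivative (r s - (L + d)) * m s) (at s)"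
        by (auto intro!: derivative_eq_intros m n simp: algebra_simps)
      moreover have "(r s - (L + d)) * m s \<le> 0"
        using T[OF \<open>s \<ge> T\<close>] m_pos[of s] by (intro mult_nonpos_nonneg) auto
      ultimately show "\<exists>D. ((\<lambda>t. (L + d) * n t - m t) has_real_derivative D) (at s) \<and> D \<le> 0"
        by blast
    qed (auto intro!: tendsto_eq_intros m0 n0)
    ultimately show ?thesis by (auto simp: algebra_simps abs_le_iff)
  qed
  show "\<forall>\<^sub>F t in at_top. dist (m t / n t) L < e"
    using eventually_ge_at_top[of T]
  proof eventually_elim
    case (elim t)
    have "m t / n t - L = (m t - L * n t) / n t"
      using n_pos[of t] by (simp add: field_simps)
    also have "\<bar>\<dots>\<bar> \<le> d"
      using *[OF elim] n_pos[of t] by (simp add: field_simps)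
    finally show ?case using d by (simp add: dist_real_def)
  qed
qed

lemma has_vector_derivative_vecI:
  fixes y :: "real \<Rightarrow> real^'n::finite"
  assumes "\<And>i. ((\<lambda>t. y t $ i) has_real_derivative y' $ i) (at t within A)"
  shows "(y has_vector_derivative y') (at t within A)"
  unfolding has_vector_derivative_def
proof (subst has_derivative_componentwise_within, rule ballI)
  fix b :: "real^'n" assume "b \<in> Basis"
  then obtain i where b: "b = axis i 1" by (auto simp: Basis_vec_def)
  show "((\<lambda>t. y t \<bullet> b) has_derivative (\<lambda>h. (h *\<^sub>R y') \<bullet> b)) (at t within A)"
    using assms[of i] unfolding has_field_derivative_def
    by (simp add: b inner_axis mult.commute[of _ "y' $ i"])
qed

lemma has_real_derivative_powr_of_exponential:
  fixes w :: "real \<Rightarrow> real"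
  assumes "w t > 0" "(w has_real_derivative r * w t) (at t)"
  shows "((\<lambda>t. w t powr e) has_real_derivative e * r * w t powr e) (at t)"
  using assms by (auto intro!: derivative_eq_intros simp: powr_diff)

lemma ex_antiderivative:
  fixes h :: "real \<Rightarrow> real"
  assumes "\<And>t. isCont h t"
  obtains H where "\<And>t. (H has_real_derivative h t) (at t)" "H t0 = c"
proof -
  obtain H where "\<And>t. (H has_real_derivative h t) (at t)"
    using einterval_antiderivative[of "-\<infinity>" \<infinity> h] assms
    by (auto simp: has_real_derivative_iff_has_vector_derivative)
  then have "((\<lambda>t. H t - H t0 + c) has_real_derivative h t) (at t)" for t
    by (auto intro!: derivative_eq_intros)
  then show ?thesis using that[of "\<lambda>t. H t - H t0 + c"] by simp
qed

text \<open>
  Once \<open>r > L / 2\<close>, the function \<open>M + (2 / L) m\<close> is decreasing. It therefore bounds the increasing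
  function \<open>M\<close>.
\<close>

lemma finite_total_time:
  fixes m r M :: "real \<Rightarrow> real"
  assumes m: "\<And>t. (m has_real_derivative - r t * m t) (at t)" and m_pos: "\<And>t. m t > 0"
    and r: "(r \<longlongrightarrow> L) at_top" and "L > 0"
    and M: "\<And>t. (M has_real_derivative m t) (at t)"
  obtains B where "(M \<longlongrightarrow> B) at_top" "\<And>t. M t < B"
proof -
  have mono: "M t < M t'" if "t < t'" for t t'
    by (rule DERIV_pos_imp_increasing[OF that]) (use M m_pos in blast)
  then have mono': "M t \<le> M t'" if "t \<le> t'" for t t'
    using that by (cases "t = t'") (auto intro: less_imp_le)
  obtain T0 where T0: "\<And>t. t \<ge> T0 \<Longrightarrow> r t > L / 2"
    using order_tendstoD(1)[OF r, of "L / 2"] \<open>L > 0\<close> by (auto simp: eventually_at_top_linorder)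
  define h where "h t = M t + 2 / L * m t" for t
  have bound: "M t \<le> h T0" for t
  proof (cases "t \<le> T0")
    case True
    have "M t \<le> M T0" by (rule mono'[OF True])
    also have "\<dots> \<le> h T0" using m_pos[of T0] \<open>L > 0\<close> by (simp add: h_def)
    finally show ?thesis .
  next
    case False
    have "h t \<le> h T0"
    proof (rule DERIV_nonpos_imp_nonincreasing[of T0 t h])
      show "T0 \<le> t" using False by simp
      fix x assume "T0 \<le> x"
      have "(h has_real_derivative (1 - 2 / L * r x) * m x) (at x)"
        unfolding h_def using \<open>L > 0\<close> by (auto intro!: derivative_eq_intros m M simp: algebra_simps)
      moreover have "(1 - 2 / L * r x) * m x \<le> 0"
        using T0[OF \<open>T0 \<le> x\<close>] \<open>L > 0\<close> m_pos[of x]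
        by (intro mult_nonpos_nonneg) (auto simp: field_simps)
      ultimately show "\<exists>D. (h has_real_derivative D) (at x) \<and> D \<le> 0" by blast
    qed
    moreover have "M t \<le> h t" using m_pos[of t] \<open>L > 0\<close> by (simp add: h_def)
    ultimately show ?thesis by simp
  qed
  have bdd: "bdd_above (range M)" using bound by (auto simp: bdd_above_def)
  define B where "B = Sup (range M)"
  have le: "M t \<le> B" for t unfolding B_def by (rule cSup_upper[OF _ bdd]) simp
  have "(M \<longlongrightarrow> B) at_top"
  proof (rule increasing_tendsto)
    fix x assume "x < B"
    then obtain t where "x < M t" unfolding B_def using less_cSup_iff[OF _ bdd] by auto
    then show "\<forall>\<^sub>F t in at_top. x < M t"
      using mono' unfolding eventually_at_top_linorder by (meson less_le_trans)
  qed (use le in simp)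
  moreover have "M t < B" for t using mono[of t "t + 1"] le[of "t + 1"] by simp
  ultimately show ?thesis using that by blast
qed

text \<open>
  The functions \<open>m\<close> and \<open>M\<close> live on the whole line, so that the inverse \<open>\<sigma>\<close> of \<open>M\<close> has a two-sided
  derivative at \<open>M 0\<close> as well.
\<close>

lemma time_change_inverse:
  fixes m M :: "real \<Rightarrow> real"
  assumes M: "\<And>t. (M has_real_derivative m t) (at t)" and m_pos: "\<And>t. m t > 0"
    and lim: "(M \<longlongrightarrow> B) at_top" and bound: "\<And>t. M t < B"
  obtains \<sigma> where "\<And>t. \<sigma> (M t) = t" "\<And>x. M 0 \<le> x \<Longrightarrow> x < B \<Longrightarrow> M (\<sigma> x) = x \<and> \<sigma> x \<ge> 0"
    "\<And>x. M 0 \<le> x \<Longrightarrow> x < B \<Longrightarrow> (\<sigma> has_real_derivative inverse (m (\<sigma> x))) (at x)"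
    "filterlim \<sigma> at_top (at_left B)"
proof -
  have mono: "M t < M t'" if "t < t'" for t t'
    by (rule DERIV_pos_imp_increasing[OF that]) (use M m_pos in blast)
  then have "inj M" by (intro linorder_injI) (metis less_irrefl)
  define \<sigma> where "\<sigma> = inv M"
  have \<sigma>: "\<sigma> (M t) = t" for t using \<open>inj M\<close> by (simp add: \<sigma>_def)
  have contM: "continuous_on A M" for A
    using M by (meson DERIV_isCont continuous_at_imp_continuous_on)
  have onto: "M (\<sigma> x) = x \<and> \<sigma> x \<ge> 0" if x: "M 0 \<le> x" "x < B" for x
  proof -
    have "\<forall>\<^sub>F t in at_top. x < M t \<and> 0 \<le> t"
      using order_tendstoD(1)[OF lim x(2)] eventually_ge_at_top[of 0] by eventually_elim simp
    then obtain b where "x < M b" "0 \<le> b"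
      unfolding eventually_at_top_linorder by blast
    then obtain t where "0 \<le> t" "M t = x"
      using IVT'[of M 0 x b, OF x(1) _ _ contM] by auto
    then show ?thesis using \<sigma>[of t] by simp
  qed
  have "(\<sigma> has_real_derivative inverse (m (\<sigma> x))) (at x)" if x: "M 0 \<le> x" "x < B" for x
  proof -
    have "(\<sigma> has_derivative (\<lambda>h. inverse (m (\<sigma> x)) * h)) (at (M (\<sigma> x)))"
    proof (rule has_derivative_inverse_strong[of UNIV _ M])
      show "(M has_derivative (\<lambda>h. m (\<sigma> x) * h)) (at (\<sigma> x))"
        using M[of "\<sigma> x"] by (simp add: has_field_derivative_def)
      show "(\<lambda>h. m (\<sigma> x) * h) \<circ> (\<lambda>h. inverse (m (\<sigma> x)) * h) = id"
        using m_pos[of "\<sigma> x"] by (auto simp: fun_eq_iff)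
    qed (auto simp: \<sigma> contM)
    then show ?thesis using onto[OF x] by (simp add: has_field_derivative_def)
  qed
  moreover have "filterlim \<sigma> at_top (at_left B)"
    unfolding filterlim_at_top
  proof
    fix Z
    have "\<forall>\<^sub>F x in at_left B. x \<in> {M (max Z 0)<..<B}"
      by (rule eventually_at_leftI[OF _ bound]) simp
    then show "\<forall>\<^sub>F x in at_left B. Z \<le> \<sigma> x"
    proof eventually_elim
      case (elim x)
      have "M 0 \<le> M (max Z 0)" using mono[of 0 Z] by (auto simp: max_def)
      then have "M (max Z 0) < M (\<sigma> x)" using onto[of x] elim by auto
      then have "max Z 0 < \<sigma> x" using mono[of "\<sigma> x" "max Z 0"] by (cases "max Z 0" "\<sigma> x" rule: linorder_cases) auto
      then show ?case by simp
    qed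
  qed
  ultimately show ?thesis using that \<sigma> onto by blast
qed

section \<open>Left eigenvectors\<close>

text \<open>
  The range of \<open>A - \<mu>\<close> is orthogonal to \<open>l\<close>, so \<open>A - \<mu>\<close> is not surjective, hence not injective.
\<close>

lemma eigenval_if_left_eigenvector:
  fixes A :: "real^'n^'n" and l :: "real^'n"
  assumes "l \<noteq> 0" and l: "\<And>v. l \<bullet> (A *v v) = \<mu> * (l \<bullet> v)"
  shows "eigenval A (of_real \<mu>)"
proof -
  define h where "h v = A *v v - \<mu> *\<^sub>R v" for v
  have lin: "linear h"
    by (auto simp: h_def linear_iff matrix_vector_right_distrib algebra_simps
        matrix_vector_mult_scaleR)
  have "l \<bullet> h v = 0" for v
    by (simp add: h_def inner_diff_right l)
  with \<open>l \<noteq> 0\<close> have "\<not> surj h"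
    by (metis inner_eq_zero_iff surjD)
  with lin have "\<not> inj h"
    using linear_injective_imp_surjective by blast
  then obtain v where v: "v \<noteq> 0" "h v = 0"
    using lin linear_injective_0 by blast
  define w where "w = (\<chi> i. complex_of_real (v $ i))"
  have "w \<noteq> 0" using v(1) by (auto simp: w_def vec_eq_iff)
  moreover have "cmat A *v w = complex_of_real \<mu> *s w"
  proof (rule vec_eq_iff[THEN iffD2], rule allI)
    fix i
    have "(A *v v) $ i = \<mu> * v $ i"
      using v(2) by (simp add: h_def)
    then have "complex_of_real (\<Sum>j\<in>UNIV. A $ i $ j * v $ j) = complex_of_real (\<mu> * v $ i)"
      by (simp add: matrix_vector_mult_def)
    then show "(cmat A *v w) $ i = (complex_of_real \<mu> *s w) $ i"
      by (simp add: matrix_vector_mult_def cmat_def map_matrix_def w_def)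
  qed
  ultimately show ?thesis unfolding eigenval_def by blast
qed

section \<open>Uniqueness of solutions\<close>

lemma smooth_on_imp_differentiable: "smooth_on U f \<Longrightarrow> x \<in> U \<Longrightarrow> f differentiable (at x)"
  unfolding smooth_on_def by (metis Ck_on.simps(2))

lemma smooth_on_imp_isCont: "smooth_on U f \<Longrightarrow> x \<in> U \<Longrightarrow> isCont f x"
  by (blast intro: differentiable_imp_continuous_within smooth_on_imp_differentiable)

lemma smooth_on_imp_local_lipschitz:
  fixes f :: "'a::euclidean_space \<Rightarrow> 'a"
  assumes "open U" and f: "smooth_on U f"
  shows "local_lipschitz UNIV U (\<lambda>_::real. f)"
proof -
  have "Ck_on (Suc 0) U f" using f unfolding smooth_on_def by blast
  then have diff: "\<And>x. x \<in> U \<Longrightarrow> f differentiable (at x)"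
    and cont: "\<And>v. continuous_on U (\<lambda>x. frechet_derivative f (at x) v)" by auto
  \<comment> \<open>Local Lipschitz continuity is a notion for time-dependent fields, hence the dummy time argument.\<close>
  define f' where "f' = (\<lambda>(t::real, x). Blinfun (frechet_derivative f (at x)))"
  have f': "blinfun_apply (f' (t, x)) = frechet_derivative f (at x)" if "x \<in> U" for t x
    using diff[OF that] by (auto simp: f'_def bounded_linear_Blinfun_apply
      simp: frechet_derivative_works intro: has_derivative_bounded_linear)
  have "continuous_on (UNIV \<times> U) f'"
  proof (rule continuous_on_blinfun_componentwise)
    fix i :: 'a
    have "continuous_on (UNIV \<times> U) (\<lambda>x. frechet_derivative f (at (snd x)) i)"
      by (rule continuous_on_compose2[OF cont[of i]]) (auto intro: continuous_intros)
    then show "continuous_on (UNIV \<times> U) (\<lambda>x. f' x i)"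
      by (rule continuous_on_eq) (auto simp: f')
  qed
  then show ?thesis
    by (intro c1_implies_local_lipschitz[where f' = f'])
       (use diff f' \<open>open U\<close> in \<open>auto simp flip: frechet_derivative_works\<close>)
qed

text \<open>
  Both solutions stay in a compact set on which \<open>f\<close> is Lipschitz with some constant \<open>L\<close>, and then
  \<open>\<bar>y - z\<bar>\<^sup>2 exp (- 2 L t)\<close> is decreasing.
\<close>

lemma solution_on_unique:
  fixes f :: "'a::euclidean_space \<Rightarrow> 'a"
  assumes "open U" and f: "smooth_on U f"
    and y: "solution_on f U {a..b} y" and z: "solution_on f U {a..b} z"
    and "y a = z a" and t: "t \<in> {a..b}"
  shows "y t = z t"
proof -
  have dy: "\<And>t. t \<in> {a..b} \<Longrightarrow> (y has_vector_derivative f (y t)) (at t within {a..b})"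
   and dz: "\<And>t. t \<in> {a..b} \<Longrightarrow> (z has_vector_derivative f (z t)) (at t within {a..b})"
    using y z by (auto simp: solution_on_def)
  have cy: "continuous_on {a..b} y" and cz: "continuous_on {a..b} z"
    unfolding continuous_on_eq_continuous_within
    using has_vector_derivative_continuous[OF dy] has_vector_derivative_continuous[OF dz]
    by blast+
  define X where "X = y ` {a..b} \<union> z ` {a..b}"
  have X: "compact X" "X \<subseteq> U"
    using y z by (auto simp: X_def solution_on_def intro!: compact_Un compact_continuous_image cy cz)
  have "local_lipschitz {0} X (\<lambda>_::real. f)"
    by (rule local_lipschitz_subset[OF smooth_on_imp_local_lipschitz[OF \<open>open U\<close> f]]) (use X in auto)
  then obtain L where "\<And>t. t \<in> {0::real} \<Longrightarrow> L-lipschitz_on X f"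
    by (rule local_lipschitz_compact_implies_lipschitz[OF _ X(1), of "{0::real}" "\<lambda>_. f"]) auto
  then have "L-lipschitz_on X f" by simp
  then have L: "norm (f (y s) - f (z s)) \<le> L * norm (y s - z s)" if "s \<in> {a..b}" for s
    using that by (auto simp: lipschitz_on_def dist_norm X_def)
  define q where "q s = (y s - z s) \<bullet> (y s - z s)" for s
  define h where "h s = q s * exp (- 2 * L * s)" for s
  have "h t \<le> h a"
  proof (rule DERIV_nonpos_imp_decreasing_open[of a t h])
    show "a \<le> t" using t by simp
    have "continuous_on {a..b} h"
      unfolding h_def q_def by (intro continuous_intros cy cz)
    then show "continuous_on {a..t} h"
      by (rule continuous_on_subset) (use t in auto)
    fix s assume s: "a < s" "s < t"
    then have "s \<in> interior {a..b}" "s \<in> {a..b}" using t by auto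
    then have "(y has_vector_derivative f (y s)) (at s)" "(z has_vector_derivative f (z s)) (at s)"
      using dy[of s] dz[of s] at_within_interior[of s "{a..b}"] by metis+
    then have "((\<lambda>s. y s - z s) has_vector_derivative f (y s) - f (z s)) (at s)"
      by (rule has_vector_derivative_diff)
    from bounded_bilinear.has_vector_derivative[OF bounded_bilinear_inner this this]
    have dq: "(q has_real_derivative 2 * ((y s - z s) \<bullet> (f (y s) - f (z s)))) (at s)"
      unfolding has_real_derivative_iff_has_vector_derivative q_def
      by (simp add: inner_commute)
    have de: "((\<lambda>s. exp (- 2 * L * s)) has_real_derivative - 2 * L * exp (- 2 * L * s)) (at s)"
      by (auto intro!: derivative_eq_intros)
    have "(h has_real_derivative
        (2 * ((y s - z s) \<bullet> (f (y s) - f (z s))) - 2 * L * q s) * exp (- 2 * L * s)) (at s)"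
      unfolding h_def by (rule DERIV_cong[OF DERIV_mult[OF dq de]]) (simp add: left_diff_distrib)
    moreover have "(y s - z s) \<bullet> (f (y s) - f (z s)) \<le> L * q s"
    proof -
      have "(y s - z s) \<bullet> (f (y s) - f (z s)) \<le> norm (y s - z s) * norm (f (y s) - f (z s))"
        by (rule norm_cauchy_schwarz)
      also have "\<dots> \<le> norm (y s - z s) * (L * norm (y s - z s))"
        by (intro mult_left_mono L \<open>s \<in> {a..b}\<close>) simp
      also have "\<dots> = L * q s"
        unfolding q_def dot_square_norm power2_eq_square by (rule mult.left_commute)
      finally show ?thesis .
    qed
    then have "(2 * ((y s - z s) \<bullet> (f (y s) - f (z s))) - 2 * L * q s) * exp (- 2 * L * s) \<le> 0"
      by (intro mult_nonpos_nonneg) auto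
    ultimately show "\<exists>D. (h has_real_derivative D) (at s) \<and> D \<le> 0" by blast
  qed
  then have "q t \<le> 0"
    using \<open>y a = z a\<close> by (simp add: h_def q_def mult_le_0_iff)
  then have "(y t - z t) \<bullet> (y t - z t) = 0"
    unfolding q_def by (rule antisym) simp
  then show ?thesis by simp
qed

lemma solution_on_subset: "solution_on f U J y \<Longrightarrow> J' \<subseteq> J \<Longrightarrow> solution_on f U J' y"
  unfolding solution_on_def by (blast intro: has_vector_derivative_within_subset)

lemma Icc_subset_forward_interval:
  assumes "ereal t < T"
  shows "{t0..t} \<subseteq> forward_interval t0 T"
proof
  fix r assume r: "r \<in> {t0..t}"
  then have "ereal r \<le> ereal t" by simp
  also note assms
  finally show "r \<in> forward_interval t0 T"
    using r by (simp add: forward_interval_def)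
qed

section \<open>Dilations and asymptotic quasi-homogeneity\<close>

lemma open_admissible_set:
  fixes U :: "(real^'n::finite) set"
  assumes "admissible_set \<alpha> U"
  shows "open U"
proof -
  obtain Ut where Ut: "openin (product_topology (\<lambda>_. euclideanreal) (- hom_idx \<alpha>)) Ut"
    and U: "U = {x. restrict (\<lambda>j. x $ j) (- hom_idx \<alpha>) \<in> Ut}"
    using assms unfolding admissible_set_def by blast
  have "continuous_map euclidean (product_topology (\<lambda>_. euclideanreal) (- hom_idx \<alpha>))
          (\<lambda>x::real^'n. restrict (\<lambda>j. x $ j) (- hom_idx \<alpha>))"
    by (auto simp: continuous_map_componentwise continuous_map_iff_continuous2
        intro!: continuous_intros)
  from openin_continuous_map_preimage[OF this Ut] show ?thesis
    by (simp add: U)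
qed

lemma qh_scale_in_admissible_set:
  fixes x :: "real^'n::finite"
  assumes "admissible_set \<alpha> U" "x \<in> U"
  shows "qh_scale \<alpha> R x \<in> U"
proof -
  have "restrict (\<lambda>j. qh_scale \<alpha> R x $ j) (- hom_idx \<alpha>) = restrict (\<lambda>j. x $ j) (- hom_idx \<alpha>)"
    by (auto simp: qh_scale_def hom_idx_def)
  with assms show ?thesis unfolding admissible_set_def by auto
qed

lemma qh_scale_qh_scale: "qh_scale \<alpha> R (qh_scale \<alpha> r x) = qh_scale \<alpha> (R * r) x"
  by (simp add: qh_scale_def vec_eq_iff power_mult_distrib)

text \<open>
  Every \<open>x\<close> whose coordinates in \<open>I\<^sub>\<alpha>\<close> do not all vanish is moved to the sphere by some dilation. The
  intermediate value theorem gives the factor together with bounds that are uniform near such a point,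
  which is what transports uniform statements from the sphere.
\<close>

lemma ex_qh_scale_on_sphere:
  fixes x :: "real^'n::finite"
  assumes i: "i \<in> hom_idx \<alpha>" and "\<delta> > 0" "\<delta> \<le> \<bar>x $ i\<bar>" and "B > 0" "norm x \<le> B"
  obtains r where "min 1 (1 / B) \<le> r" "r \<le> max 1 (1 / \<delta>)"
    "(\<Sum>j\<in>hom_idx \<alpha>. (qh_scale \<alpha> r x $ j)\<^sup>2) = 1"
proof -
  define \<phi> where "\<phi> r = (\<Sum>j\<in>hom_idx \<alpha>. (qh_scale \<alpha> r x $ j)\<^sup>2)" for r
  let ?r = "min 1 (1 / B)" and ?R = "max 1 (1 / \<delta>)"
  have pos: "\<And>j. j \<in> hom_idx \<alpha> \<Longrightarrow> \<alpha> j \<noteq> 0" by (simp add: hom_idx_def)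
  have "\<phi> ?r \<le> (\<Sum>j\<in>UNIV. (?r * x $ j)\<^sup>2)"
    unfolding \<phi>_def
  proof (rule order_trans[OF sum_mono sum_mono2])
    fix j assume j: "j \<in> hom_idx \<alpha>"
    have "?r ^ \<alpha> j \<le> ?r ^ 1"
      by (rule power_decreasing) (use pos[OF j] \<open>B > 0\<close> in auto)
    then have "?r ^ \<alpha> j * \<bar>x $ j\<bar> \<le> ?r * \<bar>x $ j\<bar>" by (intro mult_right_mono) auto
    then have "\<bar>?r ^ \<alpha> j * x $ j\<bar> \<le> \<bar>?r * x $ j\<bar>"
      using \<open>B > 0\<close> by (simp add: abs_mult)
    then show "(qh_scale \<alpha> ?r x $ j)\<^sup>2 \<le> (?r * x $ j)\<^sup>2"
      by (simp add: qh_scale_def abs_le_square_iff)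
  qed auto
  also have "\<dots> = (?r * norm x)\<^sup>2"
    by (simp add: power_mult_distrib norm_vec_def L2_set_def sum_nonneg flip: sum_distrib_left)
  also have "\<dots> \<le> 1"
  proof -
    have "?r * norm x \<le> 1 / B * B" using \<open>B > 0\<close> \<open>norm x \<le> B\<close> by (intro mult_mono) auto
    then show ?thesis using \<open>B > 0\<close> by (intro power_le_one) auto
  qed
  finally have low: "\<phi> ?r \<le> 1" .
  have "1 \<le> (?R ^ \<alpha> i * x $ i)\<^sup>2"
  proof -
    have "1 \<le> ?R * \<delta>" using \<open>\<delta> > 0\<close> by (auto simp: max_def field_simps)
    also have "\<dots> \<le> ?R ^ \<alpha> i * \<bar>x $ i\<bar>"
      using pos[OF i] assms by (intro mult_mono self_le_power) auto
    finally have "1 \<le> \<bar>?R ^ \<alpha> i * x $ i\<bar>" by (simp add: abs_mult)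
    then show ?thesis by (metis abs_le_square_iff abs_one power_one)
  qed
  also have "\<dots> \<le> \<phi> ?R"
    unfolding \<phi>_def using i by (intro order_trans[OF _ member_le_sum[of i]]) (auto simp: qh_scale_def)
  finally have high: "1 \<le> \<phi> ?R" .
  have "?r \<le> ?R" by auto
  moreover have "continuous_on {?r..?R} \<phi>"
    unfolding \<phi>_def qh_scale_def by (auto intro!: continuous_intros)
  ultimately obtain r where "?r \<le> r" "r \<le> ?R" "\<phi> r = 1"
    using IVT'[of \<phi> ?r 1 ?R] low high by blast
  then show ?thesis using that by (simp add: \<phi>_def)
qed

text \<open>
  The definition gives uniformity only on the sphere. Writing \<open>x\<close> as a dilation of a point of the
  sphere by a factor \<open>1 / r\<close>, with \<open>r\<close> bounded above and away from \<open>0\<close>, the quasi-homogeneity of \<open>fk\<close>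
  turns it into uniformity near every \<open>x0\<close> with a nonzero coordinate in \<open>I\<^sub>\<alpha>\<close>.
\<close>

lemma asymp_quasi_homogeneous_locally_uniform:
  fixes x0 :: "real^'n::finite"
  assumes U: "admissible_set \<alpha> U" and f: "asymp_quasi_homogeneous \<alpha> k U f fk"
    and i: "i \<in> hom_idx \<alpha>" "x0 $ i \<noteq> 0" and "e > 0"
  obtains R0 d where "d > 0"
    "\<And>R x. R \<ge> R0 \<Longrightarrow> x \<in> U \<Longrightarrow> dist x x0 < d \<Longrightarrow>
       \<bar>f (qh_scale \<alpha> R x) $ j / R ^ (k + \<alpha> j) - fk x $ j\<bar> < e"
proof -
  define \<delta> where "\<delta> = \<bar>x0 $ i\<bar> / 2"
  define B where "B = norm x0 + \<delta>"
  have \<delta>: "\<delta> > 0" and B: "B > 0" using i by (auto simp: \<delta>_def B_def add_nonneg_pos)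
  define r0 where "r0 = min 1 (1 / B)"
  define r1 where "r1 = max 1 (1 / \<delta>)"
  have r0: "r0 > 0" and r1: "r1 \<ge> 1" using B by (auto simp: r0_def r1_def)
  define m where "m = k + \<alpha> j"
  have "e * r0 ^ m > 0" using r0 \<open>e > 0\<close> by simp
  moreover have "uniform_limit {x \<in> U. (\<Sum>i\<in>hom_idx \<alpha>. (x $ i)\<^sup>2) = 1}
            (\<lambda>R x. (f (qh_scale \<alpha> R x) $ j - R ^ m * fk x $ j) / R ^ m) (\<lambda>_. 0) at_top"
    using f unfolding asymp_quasi_homogeneous_def m_def by blast
  ultimately have "\<forall>\<^sub>F R in at_top. \<forall>x\<in>{x \<in> U. (\<Sum>i\<in>hom_idx \<alpha>. (x $ i)\<^sup>2) = 1}.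
      \<bar>(f (qh_scale \<alpha> R x) $ j - R ^ m * fk x $ j) / R ^ m\<bar> < e * r0 ^ m"
    by (auto dest!: uniform_limitD simp: dist_real_def)
  then obtain R2 where R2: "\<And>R x. R \<ge> R2 \<Longrightarrow> x \<in> U \<Longrightarrow> (\<Sum>i\<in>hom_idx \<alpha>. (x $ i)\<^sup>2) = 1 \<Longrightarrow>
      \<bar>(f (qh_scale \<alpha> R x) $ j - R ^ m * fk x $ j) / R ^ m\<bar> < e * r0 ^ m"
    unfolding eventually_at_top_linorder by blast
  \<comment> \<open>The factor \<open>R / r\<close> that acts on the sphere must be at least \<open>R2\<close>, and \<open>r\<close> is at most \<open>r1\<close>.\<close>
  show ?thesis
  proof (rule that[of \<delta> "max R2 1 * r1"])
    show "\<delta> > 0" by fact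
    fix R x assume R: "R \<ge> max R2 1 * r1" and x: "x \<in> U" "dist x x0 < \<delta>"
    have "\<bar>x $ i - x0 $ i\<bar> < \<delta>"
      using component_le_norm_cart[of "x - x0" i] x(2) by (simp add: dist_norm)
    then have xi: "\<delta> \<le> \<bar>x $ i\<bar>" by (auto simp: \<delta>_def abs_if split: if_splits)
    have "norm x \<le> norm (x - x0) + norm x0" by (metis diff_add_cancel norm_triangle_ineq)
    then have "norm x \<le> B"
      using x(2) by (simp add: B_def dist_norm)
    from ex_qh_scale_on_sphere[OF i(1) \<delta> xi B this] obtain r where
      r: "r0 \<le> r" "r \<le> r1" "(\<Sum>j\<in>hom_idx \<alpha>. (qh_scale \<alpha> r x $ j)\<^sup>2) = 1"
      unfolding r0_def r1_def by blast
    have "r > 0" using r r0 by simp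
    have "1 * 1 \<le> max R2 1 * r1" using r1 by (intro mult_mono) auto
    then have "R > 0" using R by linarith
    have "max R2 1 * r \<le> max R2 1 * r1" using r by (intro mult_left_mono) auto
    then have "max R2 1 * r \<le> R" using R by linarith
    then have "max R2 1 \<le> R / r" by (rule pos_le_divide_eq[THEN iffD2, OF \<open>r > 0\<close>])
    then have "R2 \<le> R / r" by simp
    let ?E = "f (qh_scale \<alpha> R x) $ j / R ^ m - fk x $ j"
    have hom: "fk (qh_scale \<alpha> r x) $ j = r ^ m * fk x $ j"
      using f x(1) unfolding asymp_quasi_homogeneous_def quasi_homogeneous_field_def
        quasi_homogeneous_def m_def by blast
    have "qh_scale \<alpha> (R / r) (qh_scale \<alpha> r x) = qh_scale \<alpha> R x"
      using \<open>r > 0\<close> by (simp add: qh_scale_qh_scale)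
    with R2[OF \<open>R2 \<le> R / r\<close> qh_scale_in_admissible_set[OF U x(1)] r(3)] hom
    have "\<bar>(f (qh_scale \<alpha> R x) $ j - (R / r) ^ m * (r ^ m * fk x $ j)) / (R / r) ^ m\<bar> < e * r0 ^ m"
      by simp
    also have "(f (qh_scale \<alpha> R x) $ j - (R / r) ^ m * (r ^ m * fk x $ j)) / (R / r) ^ m = r ^ m * ?E"
      using \<open>r > 0\<close> \<open>R > 0\<close> by (simp add: field_simps power_divide)
    finally have "r ^ m * \<bar>?E\<bar> < e * r0 ^ m"
      using \<open>r > 0\<close> by (simp add: abs_mult)
    also have "\<dots> \<le> e * r ^ m"
      using r r0 \<open>e > 0\<close> by (intro mult_left_mono power_mono) auto
    finally show "\<bar>f (qh_scale \<alpha> R x) $ j / R ^ (k + \<alpha> j) - fk x $ j\<bar> < e"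
      using \<open>r > 0\<close> by (simp add: m_def mult.commute)
  qed
qed

section \<open>The compactification and the function \<open>s = p\<^sup>2\<^sup>c\<close>\<close>

locale qP_weights =
  fixes \<alpha> \<beta> :: "'n::finite \<Rightarrow> nat" and a :: "'n \<Rightarrow> real" and c :: nat
  assumes a_ge_1: "\<And>i. a i \<ge> 1" and c_pos: "c > 0"
    and weights: "\<And>i. i \<in> hom_idx \<alpha> \<Longrightarrow> \<alpha> i * \<beta> i = c"
begin

abbreviation "s \<equiv> qp_sum \<alpha> \<beta> a"
abbreviation "p \<equiv> qp_p \<alpha> \<beta> a c"
abbreviation "K \<equiv> qp_kappa_inv \<alpha> \<beta> a c"
abbreviation "T \<equiv> qp_T \<alpha> \<beta> a c"
abbreviation "dil \<equiv> qh_scale \<alpha>"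

lemma \<beta>_pos: "i \<in> hom_idx \<alpha> \<Longrightarrow> \<beta> i > 0"
  using weights[of i] c_pos by (cases "\<beta> i") auto

lemma s_nonneg: "s x \<ge> 0"
  unfolding qp_sum_def using a_ge_1
  by (intro sum_nonneg mult_nonneg_nonneg) (auto simp: power_mult intro: order_trans[of 0 1])

lemma p_power: "p x ^ (2 * c) = s x"
  unfolding qp_p_def using s_nonneg[of x] c_pos
  by (cases "s x = 0") (simp_all add: powr_power)

lemma p_nonneg: "p x \<ge> 0"
  by (simp add: qp_p_def)

lemma p_less_1_iff: "p x < 1 \<longleftrightarrow> s x < 1"
  using p_nonneg[of x] c_pos power_less_one_iff[of "p x" "2 * c"] by (simp add: p_power)

lemma p_eq_1_iff: "p x = 1 \<longleftrightarrow> s x = 1"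
  by (metis p_power power_one powr_one_eq_one qp_p_def)

lemma s_dil: "s (dil R x) = R ^ (2 * c) * s x"
  unfolding qp_sum_def sum_distrib_left
proof (rule sum.cong)
  fix i assume "i \<in> hom_idx \<alpha>"
  then have "(R ^ \<alpha> i) ^ (2 * \<beta> i) = R ^ (2 * c)"
    using weights[of i] by (metis mult.left_commute power_mult)
  then show "a i * (dil R x $ i) ^ (2 * \<beta> i) = R ^ (2 * c) * (a i * (x $ i) ^ (2 * \<beta> i))"
    by (simp add: qh_scale_def power_mult_distrib)
qed simp

lemma K_pos: "s x < 1 \<Longrightarrow> K x > 0"
  by (simp add: qp_kappa_inv_def)

lemma K_power: "s x < 1 \<Longrightarrow> K x ^ (2 * c) = 1 / (1 - s x)"
  unfolding qp_kappa_inv_def using c_pos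
  by (subst powr_power) (auto simp: powr_minus_divide)

text \<open>
  In terms of \<open>\<kappa>\<close> of the point \<open>y\<close>, \<open>s (T y) = s y / (1 + s y) = 1 - \<kappa>\<^sup>-\<^sup>2\<^sup>c\<close>. So \<open>\<kappa>\<close> can be read off
  from the image, and the inverse of \<open>T\<close> is the dilation by it.
\<close>

lemma T_inverse:
  shows s_T_less_1: "s (T y) < 1" and dil_K_T: "dil (K (T y)) (T y) = y"
proof -
  have k: "qp_kappa \<alpha> \<beta> a c y = (1 + s y) powr (1 / (2 * c))"
    by (simp add: qp_kappa_def p_power)
  have pos: "1 + s y > 0" using s_nonneg[of y] by simp
  let ?k = "qp_kappa \<alpha> \<beta> a c y"
  have k_pos: "?k > 0" using pos by (simp add: k)
  have k_pow: "?k ^ (2 * c) = 1 + s y"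
    unfolding k using pos c_pos by (subst powr_power) auto
  have Ty: "T y = dil (1 / ?k) y"
    by (simp add: qp_T_def qh_scale_def power_divide)
  then have s: "s (T y) = s y / (1 + s y)"
    by (simp add: s_dil power_divide k_pow)
  then show "s (T y) < 1" using pos by simp
  have "1 - s (T y) = inverse (1 + s y)"
    using pos by (simp add: s field_simps)
  then have "K (T y) = ?k"
    using pos by (simp add: qp_kappa_inv_def k powr_minus inverse_powr powr_minus_divide)
  then show "dil (K (T y)) (T y) = y"
    using k_pos by (simp add: Ty qh_scale_qh_scale) (simp add: qh_scale_def)
qed

definition grad_s :: "real^'n \<Rightarrow> real^'n" where
  "grad_s x = (\<chi> i. if i \<in> hom_idx \<alpha> then 2 * \<beta> i * a i * (x $ i) ^ (2 * \<beta> i - 1) else 0)"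

lemma inner_grad_s:
  "grad_s x \<bullet> v = (\<Sum>i\<in>hom_idx \<alpha>. 2 * \<beta> i * a i * (x $ i) ^ (2 * \<beta> i - 1) * v $ i)"
proof -
  have "grad_s x \<bullet> v = (\<Sum>i\<in>UNIV. if i \<in> hom_idx \<alpha>
          then 2 * \<beta> i * a i * (x $ i) ^ (2 * \<beta> i - 1) * v $ i else 0)"
    by (auto simp: inner_vec_def grad_s_def intro!: sum.cong)
  then show ?thesis by (simp add: sum.If_cases)
qed

lemma s_has_derivative: "(s has_derivative (\<lambda>v. grad_s x \<bullet> v)) (at x within A)"
  unfolding qp_sum_def inner_grad_s
  by (auto intro!: derivative_eq_intros sum.cong bounded_linear_imp_has_derivative
      bounded_linear_vec_nth)

lemma isCont_s: "isCont s x"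
  by (rule has_derivative_continuous[OF s_has_derivative])

text \<open>
  This is Euler's relation for the quasi-homogeneous function \<open>s\<close>: pairing its gradient with the
  infinitesimal dilation \<open>(x\<^sub>i / \<beta>\<^sub>i)\<close> gives a multiple of \<open>s\<close>.
\<close>

lemma euler_s: "(\<Sum>i\<in>hom_idx \<alpha>. 2 * \<beta> i * a i * (x $ i) ^ (2 * \<beta> i - 1) * (x $ i / \<beta> i)) = 2 * s x"
  unfolding qp_sum_def sum_distrib_left
proof (rule sum.cong)
  fix i assume "i \<in> hom_idx \<alpha>"
  with \<beta>_pos[of i] obtain b where "\<beta> i = Suc b" by (cases "\<beta> i") auto
  then show "2 * \<beta> i * a i * (x $ i) ^ (2 * \<beta> i - 1) * (x $ i / \<beta> i) = 2 * (a i * (x $ i) ^ (2 * \<beta> i))"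
    by (simp add: field_simps)
qed simp

lemma grad_s_nonzero: "s x = 1 \<Longrightarrow> grad_s x \<noteq> 0"
proof
  assume "s x = 1" "grad_s x = 0"
  have "grad_s x \<bullet> (\<chi> i. x $ i / \<beta> i) = 2 * s x"
    unfolding inner_grad_s euler_s[symmetric] by simp
  with \<open>s x = 1\<close> \<open>grad_s x = 0\<close> show False by simp
qed

end

section \<open>The desingularized field up to the horizon\<close>

locale qP_field = qP_weights \<alpha> \<beta> a c
  for \<alpha> \<beta> :: "'n::finite \<Rightarrow> nat" and a :: "'n \<Rightarrow> real" and c :: nat +
  fixes k :: nat and U :: "(real^'n) set" and f fk :: "real^'n \<Rightarrow> real^'n"
  assumes admissible: "admissible_set \<alpha> U" and asymp: "asymp_quasi_homogeneous \<alpha> k U f fk"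
begin

abbreviation "D \<equiv> qp_Dbar \<alpha> \<beta> a c U"
abbreviation "F \<equiv> qp_ftilde \<alpha> \<beta> a c k f fk"
abbreviation "g \<equiv> qp_g \<alpha> \<beta> a c k f fk"

text \<open>
  Up to the factor \<open>c\<close> this is the growth rate of \<open>\<kappa>\<close> in the time \<open>\<tau>\<close>: \<open>d\<kappa>/d\<tau> = (G / c) \<kappa>\<close>.
\<close>

definition G :: "real^'n \<Rightarrow> real" where
  "G x = (\<Sum>j\<in>hom_idx \<alpha>. \<beta> j * a j * (x $ j) ^ (2 * \<beta> j - 1) * F x $ j)"

lemma smooth_f: "smooth_on U f" and smooth_fk: "smooth_on U fk"
  using asymp by (auto simp: asymp_quasi_homogeneous_def quasi_homogeneous_field_def)

lemma open_U: "open U"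
  using admissible by (rule open_admissible_set)

lemma D_iff: "x \<in> D \<longleftrightarrow> x \<in> U \<and> s x \<le> 1"
  unfolding qp_Dbar_def qp_D_def qp_horizon_def by (auto simp: p_less_1_iff p_eq_1_iff)

lemma F_interior: "s x < 1 \<Longrightarrow> F x $ j = f (dil (K x) x) $ j / K x ^ (k + \<alpha> j)"
  by (simp add: qp_ftilde_def p_less_1_iff Let_def)

lemma F_horizon: "s x = 1 \<Longrightarrow> F x = fk x"
  by (simp add: qp_ftilde_def p_less_1_iff)

lemma g_component:
  "g x $ i = F x $ i - (if i \<in> hom_idx \<alpha> then G x * (x $ i / \<beta> i) else 0)"
  by (simp add: qp_g_def Let_def G_def)

text \<open>
  The field \<open>g\<close> is \<open>F\<close> minus \<open>G\<close> times the infinitesimal dilation \<open>(x\<^sub>i / \<beta>\<^sub>i)\<close>. The two parts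
  contribute \<open>2 G\<close> and, by Euler's relation, \<open>2 G s\<close>; in particular \<open>g\<close> is tangent to the horizon.
\<close>

lemma grad_s_g: "grad_s x \<bullet> g x = 2 * G x * (1 - s x)"
proof -
  have "grad_s x \<bullet> g x = (\<Sum>i\<in>hom_idx \<alpha>. 2 * (\<beta> i * a i * (x $ i) ^ (2 * \<beta> i - 1) * F x $ i)
          - G x * (2 * \<beta> i * a i * (x $ i) ^ (2 * \<beta> i - 1) * (x $ i / \<beta> i)))"
    unfolding inner_grad_s by (intro sum.cong) (simp_all add: g_component algebra_simps)
  also have "\<dots> = 2 * G x - G x * (2 * s x)"
    unfolding sum_subtractf euler_s[symmetric] by (simp add: G_def sum_distrib_left)
  finally show ?thesis by (simp add: algebra_simps)
qed

lemma F_continuous_interior: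
  assumes "x0 \<in> U" "s x0 < 1"
  shows "isCont F x0"
proof -
  have "isCont (\<lambda>x. \<chi> j. f (dil (K x) x) $ j / K x ^ (k + \<alpha> j)) x0"
  proof -
    have K: "isCont K x0"
      unfolding qp_kappa_inv_def using assms(2) by (intro continuous_intros isCont_s) auto
    have dil: "isCont (\<lambda>x. dil (K x) x) x0"
      unfolding qh_scale_def isCont_def
      by (intro vec_tendstoI)
         (auto intro!: tendsto_intros isContD[OF K])
    have "isCont (\<lambda>x. f (dil (K x) x)) x0"
      by (rule isCont_o2[OF dil])
         (rule smooth_on_imp_isCont[OF smooth_f qh_scale_in_admissible_set[OF admissible assms(1)]])
    then show ?thesis
      unfolding isCont_def
      by (intro vec_tendstoI)
         (use K_pos[OF assms(2)] in \<open>auto intro!: tendsto_intros isContD[OF K]\<close>)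
  qed
  moreover have "\<forall>\<^sub>F x in nhds x0. F x = (\<chi> j. f (dil (K x) x) $ j / K x ^ (k + \<alpha> j))"
  proof -
    have "\<forall>\<^sub>F x in nhds x0. s x < 1"
      using isCont_s[of x0] assms(2) by (simp add: order_tendstoD(2) continuous_at tendsto_nhds_iff)
    then show ?thesis
      by eventually_elim (simp add: vec_eq_iff F_interior)
  qed
  ultimately show ?thesis by (simp add: isCont_cong)
qed

text \<open>
  Near the horizon \<open>\<kappa>\<close> is arbitrarily large, so the locally uniform limit makes \<open>F\<close> uniformly close to
  \<open>fk\<close>, which is continuous and equals \<open>F\<close> on the horizon itself.
\<close>

lemma F_continuous_horizon:
  assumes "x0 \<in> U" "s x0 = 1"
  shows "(F \<longlongrightarrow> F x0) (at x0 within D)"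
proof (rule vec_tendstoI, rule tendstoI)
  fix j and e :: real assume "e > 0"
  have "\<exists>i\<in>hom_idx \<alpha>. x0 $ i \<noteq> 0"
  proof (rule ccontr)
    assume "\<not> (\<exists>i\<in>hom_idx \<alpha>. x0 $ i \<noteq> 0)"
    then have "s x0 = 0"
      unfolding qp_sum_def by (intro sum.neutral ballI) (use \<beta>_pos in simp)
    with assms(2) show False by simp
  qed
  then obtain i where i: "i \<in> hom_idx \<alpha>" "x0 $ i \<noteq> 0" by blast
  have "e / 2 > 0" using \<open>e > 0\<close> by simp
  from asymp_quasi_homogeneous_locally_uniform[OF admissible asymp i this, of j]
  obtain R0 d where "d > 0" and R0:
    "\<And>R x. R \<ge> R0 \<Longrightarrow> x \<in> U \<Longrightarrow> dist x x0 < d \<Longrightarrow>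
       \<bar>f (dil R x) $ j / R ^ (k + \<alpha> j) - fk x $ j\<bar> < e / 2" by metis
  define R1 where "R1 = max R0 1"
  have R1: "R1 \<ge> R0" "R1 > 0" by (auto simp: R1_def)
  have "\<forall>\<^sub>F x in at x0 within D. dist x x0 < d"
    using \<open>d > 0\<close> eventually_at by blast
  moreover have "\<forall>\<^sub>F x in at x0 within D. dist (fk x $ j) (fk x0 $ j) < e / 2"
    by (rule tendstoD[OF tendsto_vec_nth[OF isCont_tendsto_compose[OF smooth_on_imp_isCont[OF
       smooth_fk assms(1)] tendsto_ident_at]] \<open>e / 2 > 0\<close>])
  moreover have "\<forall>\<^sub>F x in at x0 within D. 1 - s x < 1 / R1 ^ (2 * c)"
  proof (rule order_tendstoD(2))
    show "((\<lambda>x. 1 - s x) \<longlongrightarrow> 1 - s x0) (at x0 within D)"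
      by (intro tendsto_intros isCont_tendsto_compose[OF isCont_s])
  qed (use assms(2) R1 in auto)
  moreover have "\<forall>\<^sub>F x in at x0 within D. x \<in> D"
    by (simp add: eventually_at_filter)
  ultimately show "\<forall>\<^sub>F x in at x0 within D. dist (F x $ j) (F x0 $ j) < e"
  proof eventually_elim
    case (elim x)
    have x: "x \<in> U" using elim(4) by (simp add: D_iff)
    have "\<bar>F x $ j - fk x $ j\<bar> < e / 2"
    proof (cases "s x < 1")
      case True
      have "R1 ^ (2 * c) < K x ^ (2 * c)"
        unfolding K_power[OF True] using elim(3) True R1 by (simp add: field_simps)
      then have "R1 < K x"
        using K_pos[OF True] by (meson less_imp_le power_less_imp_less_base)
      then show ?thesis
        using R0[of "K x" x] R1 x elim(1) by (simp add: F_interior[OF True])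
    next
      case False
      then have "s x = 1" using elim(4) by (simp add: D_iff)
      then show ?thesis using \<open>e > 0\<close> by (simp add: F_horizon)
    qed
    with elim(2) show ?case
      unfolding dist_real_def F_horizon[OF assms(2)] by linarith
  qed
qed

lemma F_continuous: "continuous_on D F"
  unfolding continuous_on_def
proof
  fix x assume x: "x \<in> D"
  show "(F \<longlongrightarrow> F x) (at x within D)"
  proof (cases "s x < 1")
    case True
    then show ?thesis
      using F_continuous_interior x by (auto simp: D_iff isCont_def intro: tendsto_within_subset)
  next
    case False
    then show ?thesis using F_continuous_horizon x by (auto simp: D_iff)
  qed
qed

lemma G_continuous: "continuous_on D G"
  unfolding G_def by (intro continuous_intros F_continuous)

section \<open>The eigenvalue transversal to the horizon\<close>

text \<open>
  Divide the identity \<open>\<nabla>s \<bullet> g = - 2 G (s - 1)\<close> at \<open>xs + h v\<close> by \<open>h\<close> and let \<open>h\<close> tend to \<open>0\<close> from the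
  right. Because \<open>g\<close> and \<open>s - 1\<close> vanish at \<open>xs\<close>, continuity of \<open>G\<close> and \<open>\<nabla>s\<close> suffices. The set \<open>V\<close> is
  only relatively open, so \<open>v\<close> has to point to the inside of the horizon.
\<close>

lemma jacobian_normal_inward:
  assumes V: "openin (top_of_set D) V" and xs: "xs \<in> U" "s xs = 1" "xs \<in> V" and eq: "g xs = 0"
    and dg: "(g has_derivative dg) (at xs within V)"
    and v: "grad_s xs \<bullet> v < 0"
  shows "grad_s xs \<bullet> dg v = - 2 * G xs * (grad_s xs \<bullet> v)"
proof -
  define \<gamma> where "\<gamma> h = xs + h *\<^sub>R v" for h :: real
  have \<gamma>0 [simp]: "\<gamma> 0 = xs" by (simp add: \<gamma>_def)
  have d\<gamma>: "(\<gamma> has_vector_derivative v) (at 0 within A)" for A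
    unfolding \<gamma>_def by (auto intro!: derivative_eq_intros)
  have \<gamma>: "(\<gamma> \<longlongrightarrow> xs) (at_right 0)"
    using has_vector_derivative_continuous[OF d\<gamma>[of "{0<..}"]] by (simp add: continuous_within)
  have ds: "((s \<circ> \<gamma>) has_vector_derivative grad_s xs \<bullet> v) (at 0 within {0<..})"
    using vector_derivative_diff_chain_within[OF d\<gamma>] s_has_derivative[of xs] by fastforce
  then have sq: "((\<lambda>h. (s (\<gamma> h) - 1) / h) \<longlongrightarrow> grad_s xs \<bullet> v) (at_right 0)"
    using xs(2)
    by (simp add: has_field_derivative_iff flip: has_real_derivative_iff_has_vector_derivative)
  obtain W where W: "open W" "V = D \<inter> W"
    using V by (auto simp: openin_open)
  have "\<forall>\<^sub>F h in at_right 0. h > (0::real)"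
    by (simp add: eventually_at_filter)
  moreover have "\<forall>\<^sub>F h in at_right 0. (s (\<gamma> h) - 1) / h < 0"
    by (rule order_tendstoD(2)[OF sq v])
  moreover have "\<forall>\<^sub>F h in at_right 0. \<gamma> h \<in> U \<inter> W"
    by (rule topological_tendstoD[OF \<gamma>]) (use W xs open_U in auto)
  ultimately have in_V: "\<forall>\<^sub>F h in at_right 0. \<gamma> h \<in> V"
  proof eventually_elim
    case (elim h)
    then have "s (\<gamma> h) \<le> 1" by (simp add: divide_less_0_iff)
    with elim(3) show ?case by (simp add: W D_iff)
  qed
  then obtain b where b: "b > 0" "\<And>h. 0 < h \<Longrightarrow> h < b \<Longrightarrow> \<gamma> h \<in> V"
    unfolding eventually_at_right_field by blast
  from in_V have in_D: "\<forall>\<^sub>F h in at_right 0. \<gamma> h \<in> D"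
    by eventually_elim (simp add: W)
  have "\<gamma> ` {0..b / 2} \<subseteq> V"
  proof safe
    fix h assume "h \<in> {0..b / 2}"
    then show "\<gamma> h \<in> V" using b xs(3) by (cases "h = 0") auto
  qed
  then have "((g \<circ> \<gamma>) has_vector_derivative dg v) (at 0 within {0..b / 2})"
    by (intro vector_derivative_diff_chain_within[OF d\<gamma>]) (simp add: has_derivative_subset[OF dg])
  then have dg\<gamma>: "((g \<circ> \<gamma>) has_vector_derivative dg v) (at_right 0)"
    using b(1) by (simp add: at_within_Icc_at_right)
  have gq: "((\<lambda>h. (1 / h) *\<^sub>R g (\<gamma> h)) \<longlongrightarrow> dg v) (at_right 0)"
  proof (rule vec_tendstoI)
    fix i
    have "((\<lambda>h. g (\<gamma> h) $ i) has_real_derivative dg v $ i) (at_right 0)"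
      using bounded_linear.has_vector_derivative[OF bounded_linear_vec_nth[of i] dg\<gamma>]
      by (simp add: has_real_derivative_iff_has_vector_derivative)
    then show "((\<lambda>h. ((1 / h) *\<^sub>R g (\<gamma> h)) $ i) \<longlongrightarrow> dg v $ i) (at_right 0)"
      using eq by (simp add: has_field_derivative_iff)
  qed
  have grad: "((\<lambda>h. grad_s (\<gamma> h)) \<longlongrightarrow> grad_s xs) (at_right 0)"
    unfolding grad_s_def by (intro vec_tendstoI) (auto intro!: tendsto_eq_intros \<gamma>)
  have G\<gamma>: "((\<lambda>h. G (\<gamma> h)) \<longlongrightarrow> G xs) (at_right 0)"
    by (rule continuous_on_tendsto_compose[OF G_continuous \<gamma> _ in_D]) (use xs W in auto)
  have "((\<lambda>h. grad_s (\<gamma> h) \<bullet> ((1 / h) *\<^sub>R g (\<gamma> h))) \<longlongrightarrow> grad_s xs \<bullet> dg v) (at_right 0)"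
    by (intro tendsto_intros grad gq)
  moreover have "grad_s (\<gamma> h) \<bullet> ((1 / h) *\<^sub>R g (\<gamma> h)) = - 2 * G (\<gamma> h) * ((s (\<gamma> h) - 1) / h)" for h
    by (simp add: grad_s_g algebra_simps add_divide_distrib diff_divide_distrib)
  ultimately have "((\<lambda>h. - 2 * G (\<gamma> h) * ((s (\<gamma> h) - 1) / h)) \<longlongrightarrow> grad_s xs \<bullet> dg v) (at_right 0)"
    by simp
  moreover have "((\<lambda>h. - 2 * G (\<gamma> h) * ((s (\<gamma> h) - 1) / h)) \<longlongrightarrow> - 2 * G xs * (grad_s xs \<bullet> v)) (at_right 0)"
    by (intro tendsto_intros G\<gamma> sq)
  ultimately show ?thesis
    using tendsto_unique[OF trivial_limit_at_right_real] by blast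
qed

text \<open>
  The directions that point inside form an open half-space, and these span: both \<open>- \<nabla>s\<close> and
  \<open>v - t \<nabla>s\<close> with large \<open>t\<close> point inside.
\<close>

lemma jacobian_normal:
  assumes V: "openin (top_of_set D) V" and xs: "xs \<in> U" "s xs = 1" "xs \<in> V" and eq: "g xs = 0"
    and dg: "(g has_derivative dg) (at xs within V)"
  shows "grad_s xs \<bullet> dg v = - 2 * G xs * (grad_s xs \<bullet> v)"
proof -
  define l where "l = grad_s xs"
  have "l \<bullet> l > 0" using grad_s_nonzero[OF xs(2)] by (simp add: l_def)
  note inward = jacobian_normal_inward[OF V xs eq dg, folded l_def]
  define t where "t = (\<bar>l \<bullet> v\<bar> + 1) / (l \<bullet> l)"
  have t: "t * (l \<bullet> l) = \<bar>l \<bullet> v\<bar> + 1" using \<open>l \<bullet> l > 0\<close> by (simp add: t_def)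
  have 1: "l \<bullet> dg (v - t *\<^sub>R l) = - 2 * G xs * (l \<bullet> (v - t *\<^sub>R l))"
    by (rule inward) (simp add: inner_diff_right t)
  have 2: "l \<bullet> dg (- l) = - 2 * G xs * (l \<bullet> (- l))"
    by (rule inward) (use \<open>l \<bullet> l > 0\<close> in simp)
  interpret dg: linear dg by (rule has_derivative_linear[OF dg])
  have "t * (l \<bullet> dg (- l)) = t * (- 2 * G xs * (l \<bullet> (- l)))" by (simp only: 2)
  then show ?thesis
    using 1 unfolding l_def[symmetric]
    by (simp add: dg.diff dg.scaleR dg.neg inner_diff_right algebra_simps)
qed

text \<open>
  Otherwise the eigenvalue transversal to the horizon would be \<open>0\<close>.
\<close>

lemma G_nonzero_if_hyperbolic:
  assumes V: "openin (top_of_set D) V" and xs: "xs \<in> U" "s xs = 1" "xs \<in> V" and eq: "g xs = 0"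
    and "C1_on V g" and hyp: "hyperbolic_matrix (jacobian g (at xs within V))"
  shows "G xs \<noteq> 0"
proof
  assume "G xs = 0"
  have "g differentiable (at xs within V)"
    using \<open>C1_on V g\<close> xs(3) unfolding C1_on_def differentiable_def by blast
  then have "(g has_derivative (\<lambda>v. jacobian g (at xs within V) *v v)) (at xs within V)"
    by (simp add: jacobian_works)
  from jacobian_normal[OF V xs eq this] \<open>G xs = 0\<close>
  have "eigenval (jacobian g (at xs within V)) (of_real 0)"
    by (intro eigenval_if_left_eigenvector[OF grad_s_nonzero[OF xs(2)]]) simp
  with hyp show False unfolding hyperbolic_matrix_def by fastforce
qed

end

section \<open>From desingularized time to original time\<close>

locale qP_trajectory = qP_field \<alpha> \<beta> a c k U f fk
  for \<alpha> \<beta> :: "'n::finite \<Rightarrow> nat" and a :: "'n \<Rightarrow> real" and c k :: nat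
    and U :: "(real^'n) set" and f fk :: "real^'n \<Rightarrow> real^'n" +
  fixes u :: "real \<Rightarrow> real^'n" and xs :: "real^'n"
  assumes u: "solution_on g D {0..} u" and u_lim: "(u \<longlongrightarrow> xs) at_top" and u0: "s (u 0) < 1"
    and xs: "xs \<in> U" "s xs = 1"
begin

text \<open>
  The growth rate along the trajectory, continued as a constant to negative times: everything
  obtained from it by integration is then differentiable on the whole line, without a boundary at \<open>\<tau> = 0\<close>.
\<close>

definition q :: "real \<Rightarrow> real" where
  "q \<tau> = G (u (max 0 \<tau>))"

lemma u_in_D: "\<tau> \<ge> 0 \<Longrightarrow> u \<tau> \<in> D"
  and u_derivative: "\<tau> \<ge> 0 \<Longrightarrow> (u has_vector_derivative g (u \<tau>)) (at \<tau> within {0..})"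
  using u by (auto simp: solution_on_def)

lemma isCont_q: "isCont q \<tau>"
proof -
  have "continuous_on {0..} u"
    unfolding continuous_on_eq_continuous_within
    using has_vector_derivative_continuous[OF u_derivative] by simp
  then have "continuous_on UNIV (\<lambda>\<tau>. u (max 0 \<tau>))"
    by (rule continuous_on_compose2) (auto intro: continuous_intros)
  then have "continuous_on UNIV q"
    unfolding q_def by (rule continuous_on_compose2[OF G_continuous]) (auto simp: u_in_D)
  then show ?thesis by (simp add: continuous_on_eq_continuous_at)
qed

lemma q_tendsto: "(q \<longlongrightarrow> G xs) at_top"
proof -
  have "((\<lambda>\<tau>. G (u \<tau>)) \<longlongrightarrow> G xs) at_top"
  proof (rule continuous_on_tendsto_compose[OF G_continuous u_lim])
    show "xs \<in> D" using xs by (simp add: D_iff)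
    show "\<forall>\<^sub>F \<tau> in at_top. u \<tau> \<in> D"
      using eventually_ge_at_top[of 0] by eventually_elim (rule u_in_D)
  qed
  moreover have "\<forall>\<^sub>F \<tau> in at_top. q \<tau> = G (u \<tau>)"
    using eventually_ge_at_top[of 0] by eventually_elim (simp add: q_def)
  ultimately show ?thesis by (simp add: tendsto_cong)
qed

text \<open>
  The function \<open>1 - s (u \<tau>)\<close> solves a linear equation with continuous coefficient, so it equals its
  initial value times an exponential. In particular the trajectory never reaches the horizon, where
  the change of time degenerates.
\<close>

lemma distance_to_horizon:
  obtains w where "\<And>\<tau>. w \<tau> > 0" "\<And>\<tau>. (w has_real_derivative (- 2 * q \<tau>) * w \<tau>) (at \<tau>)"
    "\<And>\<tau>. \<tau> \<ge> 0 \<Longrightarrow> s (u \<tau>) = 1 - w \<tau>"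
proof -
  obtain Q where Q: "\<And>\<tau>. (Q has_real_derivative q \<tau>) (at \<tau>)" "Q 0 = 0"
    using ex_antiderivative[OF isCont_q] by blast
  define w where "w \<tau> = (1 - s (u 0)) * exp (- 2 * Q \<tau>)" for \<tau>
  have "((\<lambda>\<tau>. (1 - s (u \<tau>)) * exp (2 * Q \<tau>)) has_vector_derivative 0) (at \<tau> within {0..})"
    if "\<tau> \<in> {0..}" for \<tau>
  proof -
    have "((s \<circ> u) has_vector_derivative grad_s (u \<tau>) \<bullet> g (u \<tau>)) (at \<tau> within {0..})"
      using that by (intro vector_derivative_diff_chain_within[OF u_derivative s_has_derivative]) auto
    then have ds: "((\<lambda>\<tau>. s (u \<tau>)) has_real_derivative 2 * q \<tau> * (1 - s (u \<tau>))) (at \<tau> within {0..})"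
      using that by (simp add: has_real_derivative_iff_has_vector_derivative grad_s_g q_def o_def max_def)
    have "((\<lambda>\<tau>. (1 - s (u \<tau>)) * exp (2 * Q \<tau>)) has_real_derivative 0) (at \<tau> within {0..})"
      by (auto intro!: derivative_eq_intros ds has_field_derivative_at_within[OF Q(1)]
          simp: algebra_simps)
    then show ?thesis by (simp add: has_real_derivative_iff_has_vector_derivative)
  qed
  from has_vector_derivative_zero_constant[OF convex_real_interval(1)[of 0] this]
  obtain C where C: "\<And>\<tau>. \<tau> \<in> {0..} \<Longrightarrow> (1 - s (u \<tau>)) * exp (2 * Q \<tau>) = C"
    by blast
  show ?thesis
  proof
    show "w \<tau> > 0" for \<tau> using u0 by (simp add: w_def)
    show "(w has_real_derivative (- 2 * q \<tau>) * w \<tau>) (at \<tau>)" for \<tau>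
      unfolding w_def by (auto intro!: derivative_eq_intros Q(1))
    fix \<tau> :: real assume "\<tau> \<ge> 0"
    then have "(1 - s (u \<tau>)) * exp (2 * Q \<tau>) = 1 - s (u 0)"
      using C[of \<tau>] C[of 0] Q(2) by simp
    then have "w \<tau> = (1 - s (u \<tau>)) * exp (2 * Q \<tau>) * exp (- 2 * Q \<tau>)"
      by (simp add: w_def)
    then show "s (u \<tau>) = 1 - w \<tau>"
      by (simp add: mult.assoc flip: exp_add)
  qed
qed

text \<open>
  With \<open>m = \<kappa>\<^sup>-\<^sup>k\<close> and \<open>t = M \<tau>\<close> an antiderivative of \<open>m\<close>, the curve \<open>Z = dil \<kappa> u\<close> satisfies
  \<open>dZ/d\<tau> = m f(Z)\<close>: the term of \<open>g\<close> that contains \<open>G\<close> is cancelled by the derivative of \<open>\<kappa>\<close>.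
  Reparametrizing by the inverse \<open>\<sigma>\<close> of \<open>M\<close> gives the solution \<open>Y\<close>, and \<open>x = u \<circ> \<sigma>\<close> is its image
  under \<open>T\<close>.
\<close>

lemma pull_back_to_original_time:
  assumes "k \<ge> 1" and "G xs \<noteq> 0"
  obtains B Y x where "t0 < B" "Y t0 = dil (K (u 0)) (u 0)" "solution_on f U {t0..<B} Y"
    "\<And>t. t \<in> {t0..<B} \<Longrightarrow> s (x t) < 1 \<and> Y t = dil (K (x t)) (x t)"
    "(x \<longlongrightarrow> xs) (at_left B)" "G xs > 0"
    "((\<lambda>t. K (x t) ^ k * (B - t)) \<longlongrightarrow> c / (k * G xs)) (at_left B)"
proof -
  obtain w where w_pos: "\<And>\<tau>. w \<tau> > 0"
    and w: "\<And>\<tau>. (w has_real_derivative (- 2 * q \<tau>) * w \<tau>) (at \<tau>)"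
    and su: "\<And>\<tau>. \<tau> \<ge> 0 \<Longrightarrow> s (u \<tau>) = 1 - w \<tau>"
    using distance_to_horizon by blast
  have w0: "(w \<longlongrightarrow> 0) at_top"
  proof -
    have "((\<lambda>\<tau>. 1 - s (u \<tau>)) \<longlongrightarrow> 1 - s xs) at_top"
      by (intro tendsto_intros isCont_tendsto_compose[OF isCont_s] u_lim)
    moreover have "\<forall>\<^sub>F \<tau> in at_top. 1 - s (u \<tau>) = w \<tau>"
      using eventually_ge_at_top[of 0] by eventually_elim (simp add: su)
    ultimately show ?thesis using xs(2) by (simp add: tendsto_cong)
  qed
  \<comment> \<open>If \<open>G xs\<close> were negative, \<open>w\<close> would eventually increase, although it is positive and tends to \<open>0\<close>.\<close>
  have G_pos: "G xs > 0"
  proof (rule ccontr)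
    assume "\<not> G xs > 0"
    with \<open>G xs \<noteq> 0\<close> have "G xs < 0" by simp
    then obtain T0 where T0: "\<And>\<tau>. \<tau> \<ge> T0 \<Longrightarrow> q \<tau> < 0"
      using order_tendstoD(2)[OF q_tendsto] by (auto simp: eventually_at_top_linorder)
    have "- w T0 \<ge> 0"
    proof (rule nonneg_if_decreasing_to_0[where h = "\<lambda>\<tau>. - w \<tau>"])
      fix \<tau> assume "\<tau> \<ge> T0"
      have "((\<lambda>\<tau>. - w \<tau>) has_real_derivative 2 * q \<tau> * w \<tau>) (at \<tau>)"
        by (auto intro!: derivative_eq_intros w)
      moreover have "2 * q \<tau> * w \<tau> \<le> 0"
        using T0[OF \<open>\<tau> \<ge> T0\<close>] w_pos[of \<tau>] by (intro mult_nonpos_nonneg[of "2 * q \<tau>"]) auto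
      ultimately show "\<exists>D. ((\<lambda>\<tau>. - w \<tau>) has_real_derivative D) (at \<tau>) \<and> D \<le> 0" by blast
    qed (auto intro!: tendsto_eq_intros w0)
    with w_pos[of T0] show False by simp
  qed
  define m where "m \<tau> = w \<tau> powr (k / (2 * c))" for \<tau>
  define r where "r \<tau> = k / c * q \<tau>" for \<tau>
  have m_pos: "m \<tau> > 0" for \<tau> using w_pos[of \<tau>] by (simp add: m_def)
  have m: "(m has_real_derivative - r \<tau> * m \<tau>) (at \<tau>)" for \<tau>
    unfolding m_def
    by (rule DERIV_cong[OF has_real_derivative_powr_of_exponential[OF w_pos w]]) (simp add: r_def)
  have m0: "(m \<longlongrightarrow> 0) at_top"
    unfolding m_def using tendsto_powr'[OF w0 tendsto_const, of "k / (2 * c)"] \<open>k \<ge> 1\<close> c_pos w_pos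
    by (auto simp: less_imp_le)
  have r: "(r \<longlongrightarrow> k / c * G xs) at_top"
    unfolding r_def by (intro tendsto_intros q_tendsto)
  have L_pos: "k / c * G xs > 0" using G_pos \<open>k \<ge> 1\<close> c_pos by simp
  have "isCont m \<tau>" for \<tau> using m by (rule DERIV_isCont)
  then obtain M where M: "\<And>\<tau>. (M has_real_derivative m \<tau>) (at \<tau>)" "M 0 = t0"
    using ex_antiderivative[of m] by blast
  obtain B where B: "(M \<longlongrightarrow> B) at_top" "\<And>\<tau>. M \<tau> < B"
    using finite_total_time[OF m m_pos r L_pos M(1)] by blast
  obtain \<sigma> where \<sigma>: "\<And>\<tau>. \<sigma> (M \<tau>) = \<tau>" "\<And>t. t0 \<le> t \<Longrightarrow> t < B \<Longrightarrow> M (\<sigma> t) = t \<and> \<sigma> t \<ge> 0"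
      "\<And>t. t0 \<le> t \<Longrightarrow> t < B \<Longrightarrow> (\<sigma> has_real_derivative inverse (m (\<sigma> t))) (at t)"
      "filterlim \<sigma> at_top (at_left B)"
    using time_change_inverse[OF M(1) m_pos B, unfolded M(2)] by blast
  define \<kappa> where "\<kappa> \<tau> = w \<tau> powr (- 1 / (2 * c))" for \<tau>
  have \<kappa>_pos: "\<kappa> \<tau> > 0" for \<tau> using w_pos[of \<tau>] by (simp add: \<kappa>_def)
  have \<kappa>: "K (u \<tau>) = \<kappa> \<tau>" if "\<tau> \<ge> 0" for \<tau>
    using that by (simp add: qp_kappa_inv_def su \<kappa>_def)
  have \<kappa>_power: "\<kappa> \<tau> ^ n = w \<tau> powr (- n / (2 * c))" for \<tau> n
    using w_pos[of \<tau>] by (simp add: \<kappa>_def powr_power)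
  have m_\<kappa>: "m \<tau> = 1 / \<kappa> \<tau> ^ k" for \<tau>
    by (simp add: \<kappa>_power m_def powr_minus_divide)
  define Z where "Z \<tau> = dil (\<kappa> \<tau>) (u \<tau>)" for \<tau>
  have Z_in_U: "Z \<tau> \<in> U" if "\<tau> \<ge> 0" for \<tau>
    using u_in_D[OF that] by (simp add: Z_def D_iff qh_scale_in_admissible_set[OF admissible])
  have dZ: "(Z has_vector_derivative m \<tau> *\<^sub>R f (Z \<tau>)) (at \<tau> within {0..})" if "\<tau> \<ge> 0" for \<tau>
  proof (rule has_vector_derivative_vecI)
    fix i
    have d\<kappa>: "((\<lambda>\<tau>. \<kappa> \<tau> ^ \<alpha> i) has_real_derivative \<alpha> i / c * q \<tau> * \<kappa> \<tau> ^ \<alpha> i) (at \<tau> within {0..})"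
      unfolding \<kappa>_power
      by (rule has_field_derivative_at_within,
          rule DERIV_cong[OF has_real_derivative_powr_of_exponential[OF w_pos w]]) simp
    have du: "((\<lambda>\<tau>. u \<tau> $ i) has_real_derivative g (u \<tau>) $ i) (at \<tau> within {0..})"
      using bounded_linear.has_vector_derivative[OF bounded_linear_vec_nth[of i] u_derivative[OF that]]
      by (simp add: has_real_derivative_iff_has_vector_derivative)
    have "s (u \<tau>) < 1" using su[OF that] w_pos[of \<tau>] by simp
    then have Fu: "F (u \<tau>) $ i = f (Z \<tau>) $ i / \<kappa> \<tau> ^ (k + \<alpha> i)"
      by (simp add: F_interior \<kappa>[OF that] Z_def)
    have qG: "q \<tau> = G (u \<tau>)" using that by (simp add: q_def)
    have cancel: "\<alpha> i / c * q \<tau> * u \<tau> $ i = (if i \<in> hom_idx \<alpha> then G (u \<tau>) * (u \<tau> $ i / \<beta> i) else 0)"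
    proof (cases "i \<in> hom_idx \<alpha>")
      case True
      have "real (\<alpha> i) * \<beta> i = c" using weights[OF True] by (metis of_nat_mult)
      then show ?thesis using True c_pos \<beta>_pos[OF True] by (simp add: qG field_simps)
    qed (simp add: hom_idx_def)
    have "((\<lambda>\<tau>. \<kappa> \<tau> ^ \<alpha> i * u \<tau> $ i) has_real_derivative (m \<tau> *\<^sub>R f (Z \<tau>)) $ i) (at \<tau> within {0..})"
    proof (rule DERIV_cong[OF DERIV_mult[OF d\<kappa> du]])
      have "\<alpha> i / c * q \<tau> * \<kappa> \<tau> ^ \<alpha> i * u \<tau> $ i + g (u \<tau>) $ i * \<kappa> \<tau> ^ \<alpha> i
        = \<kappa> \<tau> ^ \<alpha> i * (\<alpha> i / c * q \<tau> * u \<tau> $ i + g (u \<tau>) $ i)"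
        by (simp add: algebra_simps)
      also have "\<dots> = \<kappa> \<tau> ^ \<alpha> i * F (u \<tau>) $ i"
        unfolding cancel g_component by simp
      also have "\<dots> = (m \<tau> *\<^sub>R f (Z \<tau>)) $ i"
        using \<kappa>_pos[of \<tau>] by (simp add: Fu m_\<kappa> power_add)
      finally show "\<alpha> i / c * q \<tau> * \<kappa> \<tau> ^ \<alpha> i * u \<tau> $ i + g (u \<tau>) $ i * \<kappa> \<tau> ^ \<alpha> i
        = (m \<tau> *\<^sub>R f (Z \<tau>)) $ i" .
    qed
    then show "((\<lambda>\<tau>. Z \<tau> $ i) has_real_derivative (m \<tau> *\<^sub>R f (Z \<tau>)) $ i) (at \<tau> within {0..})"
      by (simp add: Z_def qh_scale_def)
  qed
  have sol: "solution_on f U {t0..<B} (Z \<circ> \<sigma>)"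
    unfolding solution_on_def
  proof (intro ballI conjI)
    fix t assume "t \<in> {t0..<B}"
    then have t: "t0 \<le> t" "t < B" by auto
    have nonneg: "\<sigma> t \<ge> 0" using \<sigma>(2)[OF t] by simp
    show "(Z \<circ> \<sigma>) t \<in> U" using Z_in_U[OF nonneg] by simp
    have d\<sigma>: "(\<sigma> has_vector_derivative inverse (m (\<sigma> t))) (at t within {t0..<B})"
      using \<sigma>(3)[OF t] has_field_derivative_at_within has_real_derivative_iff_has_vector_derivative
      by blast
    have "\<sigma> ` {t0..<B} \<subseteq> {0..}" using \<sigma>(2) by auto
    from vector_diff_chain_within[OF d\<sigma> has_vector_derivative_within_subset[OF dZ[OF nonneg] this]]
    show "((Z \<circ> \<sigma>) has_vector_derivative f ((Z \<circ> \<sigma>) t)) (at t within {t0..<B})"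
      using m_pos[of "\<sigma> t"] by simp
  qed
  have "t0 < B" using B(2)[of 0] M(2) by simp
  have \<sigma>0: "\<sigma> t0 = 0" using \<sigma>(1)[of 0] M(2) by simp
  have lim: "((\<lambda>t. K (u (\<sigma> t)) ^ k * (B - t)) \<longlongrightarrow> c / (k * G xs)) (at_left B)"
  proof -
    have "((\<lambda>\<tau>. m \<tau> / (B - M \<tau>)) \<longlongrightarrow> k / c * G xs) at_top"
    proof (rule density_over_tail_tendsto[OF m _ m_pos _ m0 _ r])
      show "((\<lambda>\<tau>. B - M \<tau>) has_real_derivative - m \<tau>) (at \<tau>)" for \<tau>
        by (auto intro!: derivative_eq_intros M(1))
      show "((\<lambda>\<tau>. B - M \<tau>) \<longlongrightarrow> 0) at_top"
        by (auto intro!: tendsto_eq_intros B(1))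
    qed (use B(2) in simp)
    then have "((\<lambda>\<tau>. inverse (m \<tau> / (B - M \<tau>))) \<longlongrightarrow> inverse (k / c * G xs)) at_top"
      by (rule tendsto_inverse[OF _ less_imp_neq[OF L_pos, symmetric]])
    from filterlim_compose[OF this \<sigma>(4)]
    have "((\<lambda>t. inverse (m (\<sigma> t) / (B - M (\<sigma> t)))) \<longlongrightarrow> c / (k * G xs)) (at_left B)"
      by simp
    moreover have "\<forall>\<^sub>F t in at_left B. t \<in> {t0<..<B}"
      using \<open>t0 < B\<close> by (intro eventually_at_leftI[of t0]) auto
    then have "\<forall>\<^sub>F t in at_left B. inverse (m (\<sigma> t) / (B - M (\<sigma> t))) = K (u (\<sigma> t)) ^ k * (B - t)"
      by eventually_elim (use \<sigma>(2) \<kappa> in \<open>auto simp: m_\<kappa>\<close>)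
    ultimately show ?thesis by (simp add: tendsto_cong)
  qed
  show ?thesis
  proof (rule that[of B "Z \<circ> \<sigma>" "u \<circ> \<sigma>"])
    show "(Z \<circ> \<sigma>) t0 = dil (K (u 0)) (u 0)" by (simp add: \<sigma>0 Z_def \<kappa>)
    show "s ((u \<circ> \<sigma>) t) < 1 \<and> (Z \<circ> \<sigma>) t = dil (K ((u \<circ> \<sigma>) t)) ((u \<circ> \<sigma>) t)" if "t \<in> {t0..<B}" for t
      using \<sigma>(2)[of t] that su[of "\<sigma> t"] w_pos[of "\<sigma> t"] by (simp add: Z_def \<kappa>)
    show "((u \<circ> \<sigma>) \<longlongrightarrow> xs) (at_left B)"
      using filterlim_compose[OF u_lim \<sigma>(4)] by (simp add: o_def)
  qed (use \<open>t0 < B\<close> sol lim G_pos in \<open>simp_all add: o_def\<close>)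
qed

end

section \<open>Blow-up rates\<close>

context qP_weights begin

lemma p_dil:
  assumes "R > 0"
  shows "p (dil R x) = R * p x"
proof -
  have "(R ^ (2 * c)) powr (1 / (2 * c)) = R"
    using assms c_pos by (simp add: powr_powr flip: powr_realpow)
  then show ?thesis
    using assms s_nonneg[of x] by (simp add: qp_p_def s_dil powr_mult)
qed

text \<open>
  The hypothesis on \<open>K\<^sup>k (B - t)\<close> says that \<open>R = K (B - t)\<^bsup>1/k\<^esup>\<close> has a positive limit, and
  \<open>p (y t)\<close> and \<open>y t $ i\<close> are \<open>R p(x t)\<close> and \<open>R\<^bsup>\<alpha> i\<^esup> x t $ i\<close> up to the claimed power of \<open>B - t\<close>.
\<close>

lemma asymptotics_at_horizon:
  assumes "k \<ge> 1" and x: "(x \<longlongrightarrow> xs) (at_left B)" and xs: "s xs = 1"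
    and y: "\<forall>\<^sub>F t in at_left B. s (x t) < 1 \<and> y t = dil (K (x t)) (x t)"
    and lim: "((\<lambda>t. K (x t) ^ k * (B - t)) \<longlongrightarrow> \<Lambda>) (at_left B)" and "\<Lambda> > 0"
  shows "asymp_proportional (\<lambda>t. p (y t)) (\<lambda>t. (B - t) powr (- 1 / real k)) (at_left B)"
    and "xs $ i \<noteq> 0 \<Longrightarrow>
      asymp_proportional (\<lambda>t. y t $ i) (\<lambda>t. (B - t) powr (- real (\<alpha> i) / real k)) (at_left B)"
proof -
  define R where "R t = K (x t) * (B - t) powr (1 / k)" for t
  define R\<^sub>0 where "R\<^sub>0 = \<Lambda> powr (1 / k)"
  have R\<^sub>0: "R\<^sub>0 > 0" using \<open>\<Lambda> > 0\<close> by (simp add: R\<^sub>0_def)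
  have ev: "\<forall>\<^sub>F t in at_left B. t < B \<and> s (x t) < 1 \<and> y t = dil (K (x t)) (x t)"
    using y eventually_at_left_real[of "B - 1" B] by (auto elim: eventually_elim2)
  have "((\<lambda>t. (K (x t) ^ k * (B - t)) powr (1 / k)) \<longlongrightarrow> R\<^sub>0) (at_left B)"
    unfolding R\<^sub>0_def using \<open>\<Lambda> > 0\<close> by (intro tendsto_intros lim) auto
  moreover have "\<forall>\<^sub>F t in at_left B. (K (x t) ^ k * (B - t)) powr (1 / k) = R t"
    using ev
  proof eventually_elim
    case (elim t)
    then have "K (x t) > 0" by (simp add: K_pos)
    moreover have "(K (x t) ^ k) powr (1 / k) = K (x t)"
      using \<open>K (x t) > 0\<close> \<open>k \<ge> 1\<close> by (simp add: powr_powr flip: powr_realpow)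
    ultimately show ?case using elim by (simp add: powr_mult R_def)
  qed
  ultimately have R: "(R \<longlongrightarrow> R\<^sub>0) (at_left B)" by (simp add: tendsto_cong)
  have "((\<lambda>t. R t * p (x t)) \<longlongrightarrow> R\<^sub>0 * p xs) (at_left B)"
    unfolding qp_p_def using xs
    by (intro tendsto_intros R isCont_tendsto_compose[OF isCont_s x]) auto
  moreover have "\<forall>\<^sub>F t in at_left B. R t * p (x t) = p (y t) / (B - t) powr (- 1 / real k)"
    using ev by eventually_elim (simp add: p_dil K_pos R_def powr_minus_divide)
  ultimately have "((\<lambda>t. p (y t) / (B - t) powr (- 1 / real k)) \<longlongrightarrow> R\<^sub>0 * p xs) (at_left B)"
    by (simp add: tendsto_cong)
  moreover have "p xs = 1" using xs by (simp add: p_eq_1_iff)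
  ultimately show "asymp_proportional (\<lambda>t. p (y t)) (\<lambda>t. (B - t) powr (- 1 / real k)) (at_left B)"
    unfolding asymp_proportional_def using R\<^sub>0 by (intro exI[of _ "R\<^sub>0 * p xs"]) auto
  assume "xs $ i \<noteq> 0"
  have "((\<lambda>t. R t ^ \<alpha> i * x t $ i) \<longlongrightarrow> R\<^sub>0 ^ \<alpha> i * xs $ i) (at_left B)"
    by (intro tendsto_intros R x)
  moreover have "\<forall>\<^sub>F t in at_left B. R t ^ \<alpha> i * x t $ i = y t $ i / (B - t) powr (- real (\<alpha> i) / real k)"
    using ev
  proof eventually_elim
    case (elim t)
    then show ?case
      by (simp add: qh_scale_def R_def power_mult_distrib powr_power powr_minus_divide)
  qed
  ultimately have "((\<lambda>t. y t $ i / (B - t) powr (- real (\<alpha> i) / real k)) \<longlongrightarrow> R\<^sub>0 ^ \<alpha> i * xs $ i) (at_left B)"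
    by (simp add: tendsto_cong)
  then show "asymp_proportional (\<lambda>t. y t $ i) (\<lambda>t. (B - t) powr (- real (\<alpha> i) / real k)) (at_left B)"
    unfolding asymp_proportional_def using R\<^sub>0 \<open>xs $ i \<noteq> 0\<close>
    by (intro exI[of _ "R\<^sub>0 ^ \<alpha> i * xs $ i"]) auto
qed

end

text \<open>
  By uniqueness \<open>y\<close> agrees with the solution \<open>Y\<close> on their common interval. If \<open>tmax < B\<close>, then \<open>Y\<close>
  would extend \<open>y\<close>. If \<open>B < tmax\<close>, then \<open>y\<close> would be continuous at \<open>B\<close>, although \<open>s (y t)\<close> is unbounded
  there.
\<close>

lemma (in qP_trajectory) maximal_solution_blows_up:
  assumes "k \<ge> 1" and "G xs \<noteq> 0"
    and y: "maximal_forward_solution f U t0 tmax y" and Ty: "u 0 = T (y t0)"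
  obtains B x where "tmax = ereal B"
    "\<forall>\<^sub>F t in at_left B. s (x t) < 1 \<and> y t = dil (K (x t)) (x t)"
    "(x \<longlongrightarrow> xs) (at_left B)" "G xs > 0"
    "((\<lambda>t. K (x t) ^ k * (B - t)) \<longlongrightarrow> c / (k * G xs)) (at_left B)"
proof -
  obtain B Y x where B: "t0 < B" and Y0: "Y t0 = dil (K (u 0)) (u 0)"
    and Y: "solution_on f U {t0..<B} Y"
    and x: "\<And>t. t \<in> {t0..<B} \<Longrightarrow> s (x t) < 1 \<and> Y t = dil (K (x t)) (x t)"
    and x_lim: "(x \<longlongrightarrow> xs) (at_left B)" and "G xs > 0"
    and lim: "((\<lambda>t. K (x t) ^ k * (B - t)) \<longlongrightarrow> c / (k * G xs)) (at_left B)"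
    by (rule pull_back_to_original_time[where ?t0.0 = t0, OF assms(1,2)], rule that)
  have sol_y: "solution_on f U (forward_interval t0 tmax) y"
    and maximal: "\<And>T' z. tmax < T' \<Longrightarrow> \<forall>t\<in>forward_interval t0 tmax. z t = y t \<Longrightarrow>
             \<not> solution_on f U (forward_interval t0 T') z"
    using y unfolding maximal_forward_solution_def by blast+
  have ev: "\<forall>\<^sub>F t in at_left B. t \<in> {t0<..<B}"
    using B by (intro eventually_at_leftI[of t0]) auto
  have "Y t0 = y t0" by (simp add: Y0 Ty dil_K_T)
  have agree: "y t = Y t" if "t \<in> forward_interval t0 tmax" "t < B" for t
  proof -
    have "{t0..t} \<subseteq> forward_interval t0 tmax"
      using that(1) by (intro Icc_subset_forward_interval) (simp add: forward_interval_def)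
    moreover have "{t0..t} \<subseteq> {t0..<B}" using that(2) by auto
    moreover have "t \<in> {t0..t}" using that(1) by (simp add: forward_interval_def)
    ultimately show ?thesis
      using solution_on_unique[OF open_U smooth_f, of t0 t y Y t] \<open>Y t0 = y t0\<close>
        solution_on_subset[OF sol_y] solution_on_subset[OF Y] by simp
  qed
  have "\<not> tmax < ereal B"
  proof
    assume less: "tmax < ereal B"
    have "\<forall>t\<in>forward_interval t0 tmax. Y t = y t"
    proof
      fix t assume t: "t \<in> forward_interval t0 tmax"
      then have "ereal t < tmax" by (simp add: forward_interval_def)
      also note less
      finally have "ereal t < ereal B" .
      then show "Y t = y t" using agree[OF t] by simp
    qed
    moreover have "forward_interval t0 (ereal B) = {t0..<B}"
      by (auto simp: forward_interval_def)
    ultimately show False using maximal[OF less] Y by simp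
  qed
  moreover have "\<not> ereal B < tmax"
  proof
    assume less: "ereal B < tmax"
    then have sub: "{t0..B} \<subseteq> forward_interval t0 tmax"
      by (rule Icc_subset_forward_interval)
    have "(y has_vector_derivative f (y B)) (at B within {t0..B})"
      using solution_on_subset[OF sol_y sub] B by (simp add: solution_on_def)
    then have "(y \<longlongrightarrow> y B) (at_left B)"
      using has_vector_derivative_continuous B
      by (fastforce simp: continuous_within at_within_Icc_at_left)
    \<comment> \<open>In these terms unboundedness is the relation \<open>(1 - s (x t)) (1 + s (y t)) = 1\<close>, in which the
      first factor tends to \<open>0\<close>.\<close>
    then have "((\<lambda>t. (1 - s (x t)) * (1 + s (y t))) \<longlongrightarrow> (1 - s xs) * (1 + s (y B))) (at_left B)"
      by (intro tendsto_intros isCont_tendsto_compose[OF isCont_s] x_lim)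
    moreover have "\<forall>\<^sub>F t in at_left B. (1 - s (x t)) * (1 + s (y t)) = 1"
      using ev
    proof eventually_elim
      case (elim t)
      then have "t \<in> forward_interval t0 tmax" "t < B" using sub by auto
      with agree have "y t = Y t" by simp
      with x[of t] elim have "s (x t) < 1" "s (y t) = s (x t) / (1 - s (x t))"
        by (simp_all add: s_dil K_power[of "x t"])
      then show ?case by (simp add: field_simps)
    qed
    ultimately have "((\<lambda>t. 1) \<longlongrightarrow> (1 - s xs) * (1 + s (y B))) (at_left B)"
      by (rule Lim_transform_eventually)
    then have "1 = (1 - s xs) * (1 + s (y B))"
      by (intro tendsto_unique[OF trivial_limit_at_left_real tendsto_const])
    then show False using xs(2) by simp
  qed
  ultimately have tmax: "tmax = ereal B" by simp
  show ?thesis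
  proof (rule that[OF tmax _ x_lim \<open>G xs > 0\<close> lim])
    show "\<forall>\<^sub>F t in at_left B. s (x t) < 1 \<and> y t = dil (K (x t)) (x t)"
      using ev by eventually_elim (use agree x in \<open>auto simp: tmax forward_interval_def\<close>)
  qed
qed

theorem theorem4p1:
  fixes \<alpha> \<beta> :: "'n::finite \<Rightarrow> nat"
    and a :: "'n \<Rightarrow> real"
    and c k ns nu :: nat
    and U V :: "(real^'n) set"
    and f fk g :: "real^'n \<Rightarrow> real^'n"
    and xs :: "real^'n"
    and y :: "real \<Rightarrow> real^'n"
    and t0 :: real
    and tmax :: ereal
  defines "g \<equiv> qp_g \<alpha> \<beta> a c k f fk"
  assumes "\<exists>i. \<alpha> i \<noteq> 0"
    and "k \<ge> 1"
    and "admissible_set \<alpha> U"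
    and "asymp_quasi_homogeneous \<alpha> k U f fk"
    and "\<And>i. a i \<ge> 1"
    and "c > 0"
    and "\<And>i. i \<in> hom_idx \<alpha> \<Longrightarrow> \<alpha> i * \<beta> i = c"
    and "\<And>i. i \<notin> hom_idx \<alpha> \<Longrightarrow> \<beta> i = 0"
    and "equilibrium_at_infinity \<alpha> \<beta> a c k U f fk xs"
    and "openin (top_of_set (qp_Dbar \<alpha> \<beta> a c U)) V"
    and "qp_horizon \<alpha> \<beta> a c U \<subseteq> V"
    and "C1_on V g"
    and "hyperbolic_matrix (jacobian g (at xs within V))"
    and "n_stable (jacobian g (at xs within V)) = ns"
    and "ns > 0"
    and "n_unstable (jacobian g (at xs within V)) = nu"
    and "nu = CARD('n) - ns"
    and "maximal_forward_solution f U t0 tmax y"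
    and "\<And>t. t \<in> forward_interval t0 tmax \<Longrightarrow>
           qp_T \<alpha> \<beta> a c (y t) \<in> stable_manifold g (qp_Dbar \<alpha> \<beta> a c U) xs"
  shows "tmax < \<infinity> \<and>
    (\<exists>C. C \<noteq> 0 \<and> asymp_proportional (\<lambda>t. qp_p \<alpha> \<beta> a c (y t))
           (\<lambda>t. C * (real_of_ereal tmax - t) powr (- 1 / real k))
           (at_left (real_of_ereal tmax))) \<and>
    (\<forall>i\<in>hom_idx \<alpha>. xs $ i \<noteq> 0 \<longrightarrow>
       (\<exists>C. C \<noteq> 0 \<and> asymp_proportional (\<lambda>t. y t $ i)
              (\<lambda>t. C * (real_of_ereal tmax - t) powr (- real (\<alpha> i) / real k))
              (at_left (real_of_ereal tmax))))"
proof -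
  interpret field: qP_field \<alpha> \<beta> a c k U f fk
    by unfold_locales (use assms(4-8) in auto)
  have xs: "xs \<in> U" "qp_sum \<alpha> \<beta> a xs = 1" "xs \<in> V" and eq: "qp_g \<alpha> \<beta> a c k f fk xs = 0"
    using assms(10,12) by (auto simp: equilibrium_at_infinity_def qp_horizon_def field.p_eq_1_iff)
  have G: "field.G xs \<noteq> 0"
    using field.G_nonzero_if_hyperbolic[OF assms(11) xs eq] assms(13,14) unfolding g_def by blast
  have "t0 \<in> forward_interval t0 tmax"
    using assms(19) by (simp add: maximal_forward_solution_def forward_interval_def)
  from assms(20)[OF this] obtain u where u: "u 0 = qp_T \<alpha> \<beta> a c (y t0)"
      "solution_on (qp_g \<alpha> \<beta> a c k f fk) (qp_Dbar \<alpha> \<beta> a c U) {0..} u" "(u \<longlongrightarrow> xs) at_top"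
    unfolding stable_manifold_def g_def by blast
  interpret traj: qP_trajectory \<alpha> \<beta> a c k U f fk u xs
    by unfold_locales (use u xs field.s_T_less_1 in auto)
  obtain B x where B: "tmax = ereal B"
    and x: "\<forall>\<^sub>F t in at_left B. qp_sum \<alpha> \<beta> a (x t) < 1 \<and>
          y t = qh_scale \<alpha> (qp_kappa_inv \<alpha> \<beta> a c (x t)) (x t)"
      "(x \<longlongrightarrow> xs) (at_left B)" "field.G xs > 0"
      "((\<lambda>t. qp_kappa_inv \<alpha> \<beta> a c (x t) ^ k * (B - t)) \<longlongrightarrow> c / (k * field.G xs)) (at_left B)"
    by (rule traj.maximal_solution_blows_up[OF assms(3) G assms(19) u(1)], rule that)
  have "c / (k * field.G xs) > 0" using assms(3,7) x(3) by simp
  note asymptotics = field.asymptotics_at_horizon[OF assms(3) x(2) xs(2) x(1,4) this]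
  show ?thesis
    unfolding B real_of_ereal.simps
    using asymptotics by (intro conjI ballI impI exI[of _ "1::real"]) auto
qed

end
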